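(* A simple ring extension $R\subset S$ of length 2 has FIP, i.e. if $S=R[x]$ for some $x\in S$ and $\ell[R,S]=2$, then the set $[R,S]$ of all $R$-subalgebras of $S$ is finite.
   Context: Rings are commutative and unital; $R\subset S$ denotes a proper ring extension and $[R,S]$ the set of all $R$-subalgebras of $S$. The length $\ell[R,S]$ is the supremum of the lengths $n$ of chains $R_0\subset R_1\subset\cdots\subset R_n$ of elements of $[R,S]$. *)

theory Defs
  imports "HOL-Algebra.Finite_Extensions" "HOL-Library.Extended_Nat"
begin

text \<open>
  A ring extension \<open>R \<subset> S\<close> is given by a ring structure \<open>S\<close> and a subring \<open>R\<close> of its carrier.
  The \<open>R\<close>-subalgebras of \<open>S\<close> are then exactly the (unital) subrings of \<open>S\<close> containing \<open>R\<close>.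
  The library's \<open>subalgebra\<close> is a different notion: it only requires an additive subgroup closed
  under multiplication by \<open>R\<close>.
\<close>

definition subalgebras :: "'a set \<Rightarrow> ('a, 'b) ring_scheme \<Rightarrow> 'a set set"
  where "subalgebras R S = {T. subring T S \<and> R \<subseteq> T}"

definition ring_extension :: "'a set \<Rightarrow> ('a, 'b) ring_scheme \<Rightarrow> bool"
  where "ring_extension R S \<longleftrightarrow> cring S \<and> subring R S \<and> R \<subset> carrier S"

definition simple_ring_extension :: "'a set \<Rightarrow> ('a, 'b) ring_scheme \<Rightarrow> bool"
  where "simple_ring_extension R S \<longleftrightarrow>
    ring_extension R S \<and> (\<exists>x \<in> carrier S. carrier S = ring.simple_extension S R x)"

text \<open>
  A chain \<open>C 0 \<subset> \<dots> \<subset> C n\<close> has length \<open>n\<close>, the number of its strict inclusions.  The supremum is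
  taken in the extended naturals, so that unbounded chain lengths give \<open>\<infinity>\<close>.
\<close>

definition extension_length :: "'a set \<Rightarrow> ('a, 'b) ring_scheme \<Rightarrow> enat"
  where "extension_length R S =
    Sup {enat n | n. \<exists>C :: nat \<Rightarrow> 'a set.
           (\<forall>i\<le>n. C i \<in> subalgebras R S) \<and> (\<forall>i<n. C i \<subset> C (Suc i))}"

definition FIP :: "'a set \<Rightarrow> ('a, 'b) ring_scheme \<Rightarrow> bool"
  where "FIP R S \<longleftrightarrow> finite (subalgebras R S)"

end

theory Submission
  imports Defs "HOL-Algebra.Ideal_Product"
begin

text \<open>
  Dividing by the conductor \<open>(R : S)\<close>, we may assume that it is zero. Any two of the rings \<open>T\<close> strictly
  between \<open>R\<close> and \<open>S\<close> meet in \<open>R\<close> and generate \<open>S\<close>; suppose there are three of them, \<open>T\<^sub>1, T\<^sub>2, T\<^sub>3\<close>.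
  If \<open>r T\<^sub>1 \<subseteq> R\<close> then \<open>r S = r T\<^sub>1 T\<^sub>i \<subseteq> T\<^sub>i\<close> for \<open>i = 2, 3\<close>, so \<open>r S \<subseteq> T\<^sub>2 \<inter> T\<^sub>3 = R\<close> and \<open>r = 0\<close>. Hence
  \<open>T\<^sub>i = R + r T\<^sub>i\<close> for every nonzero \<open>r \<in> R\<close>. This forces \<open>R\<close> to be a domain, and then a field: either
  some \<open>T\<^sub>i\<close> contains no new fractions of \<open>R\<close>, and it is then finite over \<open>R\<close>, so that Nakayama's lemma
  inverts \<open>r\<close>; or all \<open>T\<^sub>i\<close> consist of fractions, in which case suitably normalised products of elements
  of \<open>T\<^sub>i\<close> and \<open>T\<^sub>j\<close> lie in \<open>R\<close>, an element of \<open>T\<^sub>1\<close> becomes integral of degree two, and \<open>T\<^sub>1\<close> would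
  have a nonzero conductor.

  Over a field \<open>R\<close>, an intermediate ring that is not a field contains some \<open>e \<notin> R\<close> with \<open>e\<^sup>2 = 0\<close> or
  \<open>e\<^sup>2 = e\<close>. Two rings of the first kind would give \<open>S = R[e, f]\<close> with \<open>e f = 0\<close>, which is not simple.
  Two of the second kind make \<open>S\<close> a span of four orthogonal idempotents, so \<open>S\<close> has finitely many
  idempotents. If some intermediate ring is a field then so is \<open>S\<close>, and Steinitz's argument applies: the
  minimal polynomial of \<open>x\<close> over \<open>T\<close> determines \<open>T\<close> and divides the one over \<open>R\<close>.
\<close>

section \<open>Subring constructions\<close>

text \<open>The coefficient sets of \<open>\<one>\<close> and of \<open>e\<close> are kept apart so
  that one construction covers \<open>R + T r\<close>, \<open>R + R e\<close> and
  \<open>T + T f\<close>.\<close>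

definition (in ring) adjoin :: "'a set \<Rightarrow> 'a set \<Rightarrow> 'a \<Rightarrow> 'a set"
  where "adjoin A T e = {a \<oplus> t \<otimes> e | a t. a \<in> A \<and> t \<in> T}"

lemma (in ring) adjoinE:
  assumes "s \<in> adjoin A T e"
  obtains a t where "a \<in> A" "t \<in> T" "s = a \<oplus> t \<otimes> e"
  using assms unfolding adjoin_def by blast

lemma (in ring) adjoinI: "a \<in> A \<Longrightarrow> t \<in> T \<Longrightarrow> a \<oplus> t \<otimes> e \<in> adjoin A T e"
  unfolding adjoin_def by blast

lemma (in ring) adjoin_incl:
  assumes "subring A R" "subring T R" "e \<in> carrier R"
  shows "A \<subseteq> adjoin A T e" and "\<And>t. t \<in> T \<Longrightarrow> t \<otimes> e \<in> adjoin A T e" and "e \<in> adjoin A T e"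
proof -
  note A = subringE[OF assms(1)] and T = subringE[OF assms(2)]
  show "A \<subseteq> adjoin A T e"
  proof
    fix a assume "a \<in> A"
    moreover from this have "a = a \<oplus> \<zero> \<otimes> e" using A(1) assms(3) by auto
    ultimately show "a \<in> adjoin A T e" using adjoinI[of a A \<zero> T e] T(2) by simp
  qed
  show *: "t \<otimes> e \<in> adjoin A T e" if "t \<in> T" for t
  proof -
    have "t \<otimes> e = \<zero> \<oplus> t \<otimes> e" using that T(1) assms(3) by auto
    thus ?thesis using adjoinI[of \<zero> A t T e] A(2) that by simp
  qed
  show "e \<in> adjoin A T e" using *[OF T(3)] assms(3) by simp
qed

text \<open>In a product of two elements only the term in \<open>e \<otimes> e\<close> leaves the
  set; the quadratic relation brings it back, and its constant part lands in \<open>A\<close>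
  because \<open>T v\<close> does. A nonzero \<open>v\<close> occurs only for the quadratic equation
  in \<open>exists_not_fraction\<close>.\<close>

lemma (in cring) adjoin_subring:
  assumes "subring A R" "subring T R" "A \<subseteq> T" "e \<in> carrier R"
    and "u \<in> T" "v \<in> carrier R" "e \<otimes> e = v \<oplus> u \<otimes> e" "\<And>t. t \<in> T \<Longrightarrow> t \<otimes> v \<in> A"
  shows "subring (adjoin A T e) R"
proof (rule subringI)
  note A = subringE[OF assms(1)] and T = subringE[OF assms(2)]
  have Ac: "\<And>a. a \<in> A \<Longrightarrow> a \<in> carrier R" and Tc: "\<And>a. a \<in> T \<Longrightarrow> a \<in> carrier R"
    using A(1) T(1) by auto
  note e = assms(4) and v = assms(6)
  show "adjoin A T e \<subseteq> carrier R" using Ac Tc e unfolding adjoin_def by auto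
  show "\<one> \<in> adjoin A T e" using adjoin_incl(1)[OF assms(1,2) e] A(3) by blast
  fix h assume "h \<in> adjoin A T e"
  then obtain a t where h: "a \<in> A" "t \<in> T" "h = a \<oplus> t \<otimes> e" by (rule adjoinE)
  have "\<ominus> h = (\<ominus> a) \<oplus> (\<ominus> t) \<otimes> e"
    unfolding h(3) using Ac[OF h(1)] Tc[OF h(2)] e by algebra
  thus "\<ominus> h \<in> adjoin A T e" using adjoinI[OF A(5)[OF h(1)] T(5)[OF h(2)], of e] by simp
  fix k assume "k \<in> adjoin A T e"
  then obtain b w where k: "b \<in> A" "w \<in> T" "k = b \<oplus> w \<otimes> e" by (rule adjoinE)
  note c = Ac[OF h(1)] Tc[OF h(2)] Ac[OF k(1)] Tc[OF k(2)] e Tc[OF assms(5)] v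
  have "h \<oplus> k = (a \<oplus> b) \<oplus> (t \<oplus> w) \<otimes> e"
    unfolding h(3) k(3) using c by algebra
  thus "h \<oplus> k \<in> adjoin A T e" using adjoinI[OF A(7)[OF h(1) k(1)] T(7)[OF h(2) k(2)], of e] by simp
  have "h \<otimes> k = a \<otimes> b \<oplus> (a \<otimes> w \<oplus> b \<otimes> t) \<otimes> e \<oplus> (t \<otimes> w) \<otimes> (e \<otimes> e)"
    unfolding h(3) k(3) using c by algebra
  also have "\<dots> = (a \<otimes> b \<oplus> (t \<otimes> w) \<otimes> v) \<oplus> (a \<otimes> w \<oplus> b \<otimes> t \<oplus> (t \<otimes> w) \<otimes> u) \<otimes> e"
    unfolding assms(7) using c by algebra
  also have "\<dots> \<in> adjoin A T e"
  proof (rule adjoinI)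
    show "a \<otimes> b \<oplus> (t \<otimes> w) \<otimes> v \<in> A"
      using A(6)[OF h(1) k(1)] assms(8)[OF T(6)[OF h(2) k(2)]] by (rule A(7))
    show "a \<otimes> w \<oplus> b \<otimes> t \<oplus> (t \<otimes> w) \<otimes> u \<in> T"
      by (intro T(6,7) assms(5) h(2) k(2) subsetD[OF assms(3)] h(1) k(1))
  qed
  finally show "h \<otimes> k \<in> adjoin A T e" .
qed

lemma (in cring) adjoin_subring':
  assumes "subring A R" "subring T R" "A \<subseteq> T" "e \<in> carrier R" "u \<in> T" "e \<otimes> e = u \<otimes> e"
  shows "subring (adjoin A T e) R"
proof -
  have c: "u \<in> carrier R" using subringE(1)[OF assms(2)] assms(5) by auto
  have t: "t \<otimes> \<zero> \<in> A" if "t \<in> T" for t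
    using that subringE(1)[OF assms(2)] subringE(2)[OF assms(1)] by auto
  show ?thesis
    by (rule adjoin_subring[OF assms(1-5) zero_closed _ t]) (use assms c in auto)
qed

text \<open>\<open>simple_extension\<close> is generated by Horner steps
  \<open>k1 \<otimes> x \<oplus> k2\<close>. Closure under products is assembled from scaling by
  \<open>K\<close>, sums and multiplication by \<open>x\<close>, each by induction over these steps
  or from one such step.\<close>

lemma (in cring) simple_extension_subring:
  assumes "subring K R" "x \<in> carrier R"
  shows "subring (simple_extension K x) R"
proof (rule subringI)
  let ?E = "simple_extension K x"
  note K = subringE[OF assms(1)]
  have Kc: "\<And>a. a \<in> K \<Longrightarrow> a \<in> carrier R" using K(1) by auto
  show E: "?E \<subseteq> carrier R" using simple_extension_in_carrier[OF K(1) assms(2)] .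
  hence Ec: "\<And>a. a \<in> ?E \<Longrightarrow> a \<in> carrier R" by auto
  note inc = simple_extension_incl[OF K(1) assms(2)]
  show "\<one> \<in> ?E" using inc K(3) by auto
  have smult: "c \<otimes> h \<in> ?E" if "c \<in> K" "h \<in> ?E" for c h
    using that(2)
  proof (induction rule: simple_extension.induct)
    case zero thus ?case using Kc[OF that(1)] by simp
  next
    case (lin k1 k2)
    have "c \<otimes> (k1 \<otimes> x \<oplus> k2) = (c \<otimes> k1) \<otimes> x \<oplus> c \<otimes> k2"
      using Kc[OF that(1)] Ec[OF lin(1)] Kc[OF lin(2)] assms(2) by algebra
    thus ?case using simple_extension.lin[OF lin.IH K(6)[OF that(1) lin(2)]] by simp
  qed
  show "\<ominus> h \<in> ?E" if "h \<in> ?E" for h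
  proof -
    have "\<ominus> h = (\<ominus> \<one>) \<otimes> h" using Ec[OF that] by algebra
    thus ?thesis using smult[OF K(5)[OF K(3)] that] by simp
  qed
  have add: "h \<oplus> k \<in> ?E" if "h \<in> ?E" "k \<in> ?E" for h k
    using that
  proof (induction arbitrary: k rule: simple_extension.induct)
    case zero thus ?case using Ec by simp
  next
    case (lin k1 k2)
    from \<open>k \<in> ?E\<close> show ?case
    proof (cases rule: simple_extension.cases)
      case zero thus ?thesis
        using simple_extension.lin[OF lin(1,2)] Ec by auto
    next
      case (lin l1 l2)
      have "k1 \<otimes> x \<oplus> k2 \<oplus> k = (k1 \<oplus> l1) \<otimes> x \<oplus> (k2 \<oplus> l2)"
        unfolding lin using Ec[OF \<open>k1 \<in> ?E\<close>] Ec[OF lin(2)] Kc[OF \<open>k2 \<in> K\<close>] Kc[OF lin(3)] assms(2)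
        by algebra
      thus ?thesis
        using simple_extension.lin[OF _ K(7)[OF \<open>k2 \<in> K\<close> lin(3)]] \<open>\<And>k. k \<in> ?E \<Longrightarrow> k1 \<oplus> k \<in> ?E\<close> lin(2)
        by simp
    qed
  qed
  show "\<And>h k. h \<in> ?E \<Longrightarrow> k \<in> ?E \<Longrightarrow> h \<oplus> k \<in> ?E" by (rule add)
  have xmult: "h \<otimes> x \<in> ?E" if "h \<in> ?E" for h
    using simple_extension.lin[OF that K(2)] Ec[OF that] assms(2) by simp
  show "h \<otimes> k \<in> ?E" if "h \<in> ?E" "k \<in> ?E" for h k
    using that(1)
  proof (induction rule: simple_extension.induct)
    case zero thus ?case using Ec[OF that(2)] by simp
  next
    case (lin k1 k2)
    have "(k1 \<otimes> x \<oplus> k2) \<otimes> k = (k1 \<otimes> k) \<otimes> x \<oplus> k2 \<otimes> k"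
      using Ec[OF lin(1)] Kc[OF lin(2)] Ec[OF that(2)] assms(2) by algebra
    thus ?case using add[OF xmult[OF lin.IH] smult[OF lin(2) that(2)]] by simp
  qed
qed

text \<open>For subrings of a commutative ring the finite sums of products \<open>a b\<close> form
  the compositum. This description allows facts about the join of two intermediate rings to be
  proved by induction on products and sums.\<close>

lemma (in cring) ideal_prod_subring:
  assumes "subring A R" "subring B R"
  shows "subring (ideal_prod R A B) R" and "A \<subseteq> ideal_prod R A B" and "B \<subseteq> ideal_prod R A B"
proof -
  note A = subringE[OF assms(1)] and B = subringE[OF assms(2)]
  have Ac: "\<And>a. a \<in> A \<Longrightarrow> a \<in> carrier R" and Bc: "\<And>a. a \<in> B \<Longrightarrow> a \<in> carrier R"
    using A(1) B(1) by auto
  show inA: "A \<subseteq> ideal_prod R A B"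
  proof
    fix a assume "a \<in> A" thus "a \<in> ideal_prod R A B"
      using ideal_prod.prod[of a A \<one> B R] B(3) Ac by simp
  qed
  show "B \<subseteq> ideal_prod R A B"
  proof
    fix b assume "b \<in> B" thus "b \<in> ideal_prod R A B"
      using ideal_prod.prod[of \<one> A b B R] A(3) Bc by simp
  qed
  have Pc: "s \<in> carrier R" if "s \<in> ideal_prod R A B" for s
    using that by (induction rule: ideal_prod.induct) (auto simp: Ac Bc)
  show "subring (ideal_prod R A B) R"
  proof (rule subringI)
    show "ideal_prod R A B \<subseteq> carrier R" using Pc by auto
    show "\<one> \<in> ideal_prod R A B" using inA A(3) by auto
    \<comment> \<open>One generator times an arbitrary element comes first; the general product
      follows by induction on the left factor.\<close>
    have lmult: "(a \<otimes> b) \<otimes> s \<in> ideal_prod R A B" if "a \<in> A" "b \<in> B" "s \<in> ideal_prod R A B" for a b s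
      using that(3)
    proof (induction rule: ideal_prod.induct)
      case (prod i j)
      have "(a \<otimes> b) \<otimes> (i \<otimes> j) = (a \<otimes> i) \<otimes> (b \<otimes> j)"
        using Ac[OF that(1)] Bc[OF that(2)] Ac[OF prod(1)] Bc[OF prod(2)] by algebra
      thus ?case using ideal_prod.prod[OF A(6)[OF that(1) prod(1)] B(6)[OF that(2) prod(2)], of R] by simp
    next
      case (sum s1 s2)
      have "(a \<otimes> b) \<otimes> (s1 \<oplus> s2) = (a \<otimes> b) \<otimes> s1 \<oplus> (a \<otimes> b) \<otimes> s2"
        using Ac[OF that(1)] Bc[OF that(2)] Pc[OF sum(1)] Pc[OF sum(2)] by algebra
      thus ?case using ideal_prod.sum[OF sum.IH, of ] by simp
    qed
    show "s \<otimes> t \<in> ideal_prod R A B" if "s \<in> ideal_prod R A B" "t \<in> ideal_prod R A B" for s t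
      using that(1)
    proof (induction rule: ideal_prod.induct)
      case (prod i j) thus ?case using lmult[OF _ _ that(2)] by blast
    next
      case (sum s1 s2)
      have "(s1 \<oplus> s2) \<otimes> t = s1 \<otimes> t \<oplus> s2 \<otimes> t"
        using Pc[OF sum(1)] Pc[OF sum(2)] Pc[OF that(2)] by algebra
      thus ?case using ideal_prod.sum[OF sum.IH] by simp
    qed
    show "s \<oplus> t \<in> ideal_prod R A B" if "s \<in> ideal_prod R A B" "t \<in> ideal_prod R A B" for s t
      using ideal_prod.sum[OF that] .
    show "\<ominus> s \<in> ideal_prod R A B" if "s \<in> ideal_prod R A B" for s
    proof -
      have "\<ominus> s = ((\<ominus> \<one>) \<otimes> \<one>) \<otimes> s" using Pc[OF that] by algebra
      thus ?thesis using lmult[OF A(5)[OF A(3)] B(3) that] by simp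
    qed
  qed
qed

section \<open>Simple extensions of length two\<close>

text \<open>Simplicity and length enter as statements about all intermediate rings. In this form
  both pass to a quotient by taking preimages.\<close>

locale length_two_extension = cring S for S (structure) +
  fixes R :: "'a set" and x :: 'a
  assumes subring_base: "subring R S"
    and generator_closed: "x \<in> carrier S"
    and generator: "\<And>A. A \<in> subalgebras R S \<Longrightarrow> x \<in> A \<Longrightarrow> A = carrier S"
    and length_two: "\<And>A B. \<lbrakk> A \<in> subalgebras R S; B \<in> subalgebras R S; A \<subseteq> B \<rbrakk>
      \<Longrightarrow> A = R \<or> A = B \<or> B = carrier S"
begin

text \<open>By \<open>length_two\<close> each such ring is at once an atom and a coatom of the
  lattice of intermediate rings.\<close>

definition atoms :: "'a set set"
  where "atoms = {T \<in> subalgebras R S. T \<noteq> R \<and> T \<noteq> carrier S}"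

lemmas base_closed = subringE(2-3,5-7)[OF subring_base]

lemma base_carrier [simp]: "r \<in> R \<Longrightarrow> r \<in> carrier S"
  using subringE(1)[OF subring_base] by auto

lemma subalgebraI: "subring A S \<Longrightarrow> R \<subseteq> A \<Longrightarrow> A \<in> subalgebras R S"
  unfolding subalgebras_def by auto

lemma subalgebraD: "A \<in> subalgebras R S \<Longrightarrow> subring A S" "A \<in> subalgebras R S \<Longrightarrow> R \<subseteq> A"
  unfolding subalgebras_def by auto

lemma base_subalgebra: "R \<in> subalgebras R S"
  using subalgebraI[OF subring_base] by simp

lemma subalgebra_inter:
  "A \<in> subalgebras R S \<Longrightarrow> B \<in> subalgebras R S \<Longrightarrow> A \<inter> B \<in> subalgebras R S"
  using subring_inter unfolding subalgebras_def by auto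

lemma atom_subring: "T \<in> atoms \<Longrightarrow> subring T S"
  and atom_base: "T \<in> atoms \<Longrightarrow> R \<subseteq> T"
  and atom_subalgebra: "T \<in> atoms \<Longrightarrow> T \<in> subalgebras R S"
  and atom_carrier: "T \<in> atoms \<Longrightarrow> t \<in> T \<Longrightarrow> t \<in> carrier S"
  and atom_neq: "T \<in> atoms \<Longrightarrow> T \<noteq> R" "T \<in> atoms \<Longrightarrow> T \<noteq> carrier S"
  using subringE(1) unfolding atoms_def subalgebras_def by blast+

lemma atom_minimal: "T \<in> atoms \<Longrightarrow> A \<in> subalgebras R S \<Longrightarrow> A \<subseteq> T \<Longrightarrow> A = R \<or> A = T"
  using length_two[of A T] unfolding atoms_def by auto

lemma atom_maximal: "T \<in> atoms \<Longrightarrow> A \<in> subalgebras R S \<Longrightarrow> T \<subseteq> A \<Longrightarrow> A = T \<or> A = carrier S"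
  using length_two[of T A] unfolding atoms_def by auto

section \<open>Meets, joins and conductors of atoms\<close>

lemma atoms_inter:
  assumes "T \<in> atoms" "U \<in> atoms" "T \<noteq> U"
  shows "T \<inter> U = R"
  using atom_minimal[OF assms(1) subalgebra_inter[OF assms(1,2)[THEN atom_subalgebra]]]
    atom_minimal[OF assms(2) atom_subalgebra[OF assms(1)]] assms(3) atom_neq(1)[OF assms(1)]
  by blast

lemma atoms_join:
  assumes "T \<in> atoms" "U \<in> atoms" "T \<noteq> U" "A \<in> subalgebras R S" "T \<subseteq> A" "U \<subseteq> A"
  shows "A = carrier S"
  using atom_maximal[OF assms(1,4,5)] atom_maximal[OF assms(2,4,6)] assms(3) by auto

lemma atom_proper_elem:
  assumes "T \<in> atoms" obtains t where "t \<in> T" "t \<notin> R"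
  using atom_neq(1)[OF assms] atom_base[OF assms] by blast

lemma simple_extension_subalgebra:
  "y \<in> carrier S \<Longrightarrow> simple_extension R y \<in> subalgebras R S"
  using subalgebraI simple_extension_subring[OF subring_base]
    simple_extension_incl[OF subringE(1)[OF subring_base]] by blast

text \<open>Minimality over \<open>R\<close>. An atom is thus determined by any one of its elements
  outside \<open>R\<close>, so that atoms can be counted by counting elements.\<close>

lemma atom_simple_extension:
  assumes "T \<in> atoms" "y \<in> T" "y \<notin> R"
  shows "simple_extension R y = T"
proof -
  have "y \<in> carrier S" using atom_carrier assms by blast
  moreover have "simple_extension R y \<subseteq> T"
    using simple_extension_subring_incl[OF atom_subring[OF assms(1)] atom_base[OF assms(1)] assms(2)] .
  ultimately show ?thesis
    using atom_minimal[OF assms(1) simple_extension_subalgebra] simple_extension_mem[OF subring_base] assms(3)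
    by blast
qed

lemma join_eq_ideal_prod:
  assumes "T \<in> atoms" "U \<in> atoms" "T \<noteq> U"
  shows "ideal_prod S T U = carrier S"
  using atoms_join[OF assms subalgebraI] ideal_prod_subring[OF assms(1,2)[THEN atom_subring]]
    atom_base[OF assms(1)] by blast

text \<open>\<open>S\<close> is spanned by products \<open>t u\<close>, and
  \<open>r (t u) = (r t) u\<close> lies in \<open>R U\<close>, hence in \<open>U\<close>.\<close>

lemma conductor_aux:
  assumes "T \<in> atoms" "U \<in> atoms" "T \<noteq> U" "r \<in> R" "\<And>t. t \<in> T \<Longrightarrow> r \<otimes> t \<in> R" "s \<in> carrier S"
  shows "r \<otimes> s \<in> U"
proof -
  have "s \<in> ideal_prod S T U" using assms(6) join_eq_ideal_prod[OF assms(1-3)] by simp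
  hence "s \<in> carrier S \<and> r \<otimes> s \<in> U"
  proof (induction rule: ideal_prod.induct)
    case (prod i j)
    have c: "i \<in> carrier S" "j \<in> carrier S" using atom_carrier assms(1,2) prod by blast+
    have "r \<otimes> (i \<otimes> j) = (r \<otimes> i) \<otimes> j" using c assms(4) by (simp add: m_assoc)
    thus ?case using c assms(5)[OF prod(1)] atom_base[OF assms(2)] prod(2)
        subringE(6)[OF atom_subring[OF assms(2)]] by auto
  next
    case (sum s1 s2)
    hence "r \<otimes> (s1 \<oplus> s2) = r \<otimes> s1 \<oplus> r \<otimes> s2" using assms(4) by (simp add: r_distr)
    thus ?case using sum subringE(7)[OF atom_subring[OF assms(2)]] by auto
  qed
  thus ?thesis by simp
qed

text \<open>This is where a third atom is decisive: \<open>r S\<close> lies in both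
  \<open>T2\<close> and \<open>T3\<close>, and these meet in \<open>R\<close>.\<close>

lemma conductor_atom:
  assumes "T1 \<in> atoms" "T2 \<in> atoms" "T3 \<in> atoms" "T1 \<noteq> T2" "T1 \<noteq> T3" "T2 \<noteq> T3"
    and "r \<in> R" "\<And>t. t \<in> T1 \<Longrightarrow> r \<otimes> t \<in> R" "s \<in> carrier S"
  shows "r \<otimes> s \<in> R"
  using conductor_aux[OF assms(1,2,4,7-9)] conductor_aux[OF assms(1,3,5,7-9)]
    atoms_inter[OF assms(2,3,6)] by blast

end

section \<open>Rings \<open>R + T r\<close> and polynomial expressions of bounded degree\<close>

context length_two_extension
begin

text \<open>\<open>R + T r\<close> is a ring because \<open>r \<otimes> r\<close> is an
  \<open>r\<close>-multiple of \<open>r\<close>. It lies between \<open>R\<close> and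
  \<open>T\<close> and contains \<open>r t\<close>, so minimality leaves only
  \<open>T\<close>.\<close>

lemma atom_adjoin_base:
  assumes "T \<in> atoms" "r \<in> R" "t \<in> T" "r \<otimes> t \<notin> R"
  shows "adjoin R T r = T"
proof -
  note T = subringE[OF atom_subring[OF assms(1)]]
  note sub = subring_base atom_subring[OF assms(1)] 
  have r: "r \<in> carrier S" using assms(2) by simp
  have "adjoin R T r \<in> subalgebras R S"
    using subalgebraI adjoin_subring'[OF sub atom_base[OF assms(1)] r, of r] adjoin_incl(1)[OF sub r]
      atom_base[OF assms(1)] assms(2) by blast
  moreover have "adjoin R T r \<subseteq> T"
    using T(6,7) atom_base[OF assms(1)] assms(2) unfolding adjoin_def by blast
  moreover have "adjoin R T r \<noteq> R"
    using adjoin_incl(2)[OF sub r assms(3)] m_comm[OF r, of t] atom_carrier[OF assms(1,3)] assms(4) by auto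
  ultimately show ?thesis using atom_minimal[OF assms(1)] by blast
qed

text \<open>The \<open>R\<close>-module spanned by the powers of \<open>y\<close> up to the exponent
  \<open>k\<close>. The recursion exposes the top coefficient, which the later inductions split
  off.\<close>

primrec power_span :: "'a \<Rightarrow> nat \<Rightarrow> 'a set" where
  "power_span y 0 = R"
| "power_span y (Suc k) = {n \<oplus> c \<otimes> y [^] Suc k | n c. n \<in> power_span y k \<and> c \<in> R}"

declare power_span.simps(2) [simp del]

lemma power_span_SucI:
  "n \<in> power_span y k \<Longrightarrow> c \<in> R \<Longrightarrow> n \<oplus> c \<otimes> y [^] Suc k \<in> power_span y (Suc k)"
  unfolding power_span.simps by blast

lemma power_span_SucE:
  assumes "s \<in> power_span y (Suc k)"
  obtains n c where "n \<in> power_span y k" "c \<in> R" "s = n \<oplus> c \<otimes> y [^] Suc k"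
  using assms unfolding power_span.simps by blast

context
  fixes y assumes y: "y \<in> carrier S"
begin

lemma power_span_carrier: "s \<in> power_span y k \<Longrightarrow> s \<in> carrier S"
proof (induction k arbitrary: s)
  case (Suc k)
  from Suc(2) obtain n c where "n \<in> power_span y k" "c \<in> R" "s = n \<oplus> c \<otimes> y [^] Suc k"
    by (rule power_span_SucE)
  thus ?case using Suc(1) y by simp
qed simp

lemma power_span_Suc: "s \<in> power_span y k \<Longrightarrow> s \<in> power_span y (Suc k)"
  using power_span_SucI[of s y k \<zero>] base_closed(1) power_span_carrier y by simp

lemma base_power_span: "r \<in> R \<Longrightarrow> r \<in> power_span y k"
  by (induction k) (simp_all add: power_span_Suc)

lemma power_span_add:
  "s \<in> power_span y k \<Longrightarrow> t \<in> power_span y k \<Longrightarrow> s \<oplus> t \<in> power_span y k"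
proof (induction k arbitrary: s t)
  case 0 thus ?case using base_closed(5) by simp
next
  case (Suc k)
  obtain n c where s: "n \<in> power_span y k" "c \<in> R" "s = n \<oplus> c \<otimes> y [^] Suc k"
    using Suc(2) by (rule power_span_SucE)
  obtain m d where t: "m \<in> power_span y k" "d \<in> R" "t = m \<oplus> d \<otimes> y [^] Suc k"
    using Suc(3) by (rule power_span_SucE)
  have "s \<oplus> t = (n \<oplus> m) \<oplus> (c \<oplus> d) \<otimes> y [^] Suc k"
    unfolding s(3) t(3)
    using power_span_carrier[OF s(1)] power_span_carrier[OF t(1)] base_carrier[OF s(2)]
      base_carrier[OF t(2)] nat_pow_closed[OF y, of "Suc k"] by algebra
  thus ?case using power_span_SucI[OF Suc(1)[OF s(1) t(1)] base_closed(5)[OF s(2) t(2)]] by simp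
qed

lemma power_span_smult:
  "r \<in> R \<Longrightarrow> s \<in> power_span y k \<Longrightarrow> r \<otimes> s \<in> power_span y k"
proof (induction k arbitrary: s)
  case 0 thus ?case using base_closed(4) by simp
next
  case (Suc k)
  obtain n c where s: "n \<in> power_span y k" "c \<in> R" "s = n \<oplus> c \<otimes> y [^] Suc k"
    using Suc(3) by (rule power_span_SucE)
  have "r \<otimes> s = r \<otimes> n \<oplus> (r \<otimes> c) \<otimes> y [^] Suc k"
    unfolding s(3)
    using power_span_carrier[OF s(1)] base_carrier[OF s(2)] base_carrier[OF Suc(2)]
      nat_pow_closed[OF y, of "Suc k"] by algebra
  thus ?case using power_span_SucI[OF Suc(1)[OF Suc(2) s(1)] base_closed(4)[OF Suc(2) s(2)]] by simp
qed

lemma power_span_diff: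
  assumes "s \<in> power_span y k" "t \<in> power_span y k"
  shows "s \<ominus> t \<in> power_span y k"
proof -
  have "s \<ominus> t = s \<oplus> (\<ominus> \<one>) \<otimes> t"
    using power_span_carrier[OF assms(1)] power_span_carrier[OF assms(2)] by algebra
  thus ?thesis
    using power_span_add[OF assms(1) power_span_smult[OF base_closed(3)[OF base_closed(2)] assms(2)]]
    by simp
qed

lemma power_span_mult:
  "s \<in> power_span y k \<Longrightarrow> s \<otimes> y \<in> power_span y (Suc k)"
proof (induction k arbitrary: s)
  case 0
  thus ?case using power_span_SucI[of \<zero> y 0 s] base_closed(1) y by simp
next
  case (Suc k)
  obtain n c where s: "n \<in> power_span y k" "c \<in> R" "s = n \<oplus> c \<otimes> y [^] Suc k"
    using Suc(2) by (rule power_span_SucE)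
  have "s \<otimes> y = n \<otimes> y \<oplus> c \<otimes> (y [^] Suc k \<otimes> y)"
    unfolding s(3)
    using power_span_carrier[OF s(1)] base_carrier[OF s(2)] y nat_pow_closed[OF y, of "Suc k"] by algebra
  hence "s \<otimes> y = n \<otimes> y \<oplus> c \<otimes> y [^] Suc (Suc k)" by simp
  thus ?case using power_span_SucI[OF Suc(1)[OF s(1)] s(2)] by simp
qed

lemma simple_extension_power_span:
  "s \<in> simple_extension R y \<Longrightarrow> \<exists>k. s \<in> power_span y k"
proof (induction rule: simple_extension.induct)
  case zero
  have "\<zero> \<in> power_span y 0" using base_closed(1) by simp
  thus ?case by blast
next
  case (lin k1 k2)
  then obtain k where "k1 \<in> power_span y k" by blast
  hence "k1 \<otimes> y \<oplus> k2 \<in> power_span y (Suc k)"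
    using power_span_add[OF power_span_mult base_power_span[OF lin(2)]] by blast
  thus ?case by blast
qed

text \<open>A monic equation of degree \<open>Suc m\<close> removes the power
  \<open>y [^] Suc m\<close> that a Horner step creates, so the span is never left.\<close>

lemma simple_extension_integral:
  assumes "y [^] Suc m \<in> power_span y m"
  shows "simple_extension R y \<subseteq> power_span y m"
proof
  fix s assume "s \<in> simple_extension R y"
  thus "s \<in> power_span y m"
  proof (induction rule: simple_extension.induct)
    case zero thus ?case using base_power_span base_closed(1) by blast
  next
    case (lin k1 k2)
    obtain n c where s: "n \<in> power_span y m" "c \<in> R" "k1 \<otimes> y = n \<oplus> c \<otimes> y [^] Suc m"
      using power_span_mult[OF lin.IH] by (rule power_span_SucE)
    show ?case unfolding s(3)
      by (intro power_span_add power_span_smult base_power_span s lin assms)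
  qed
qed

text \<open>Each term \<open>c y^i\<close> with \<open>i\<close> at most \<open>k\<close> becomes
  \<open>c b^(k-i) (b y)^i\<close>. This turns an algebraic equation with leading coefficient
  \<open>b\<close> into a monic one for \<open>b y\<close>.\<close>

lemma power_span_clear_denominator:
  assumes "b \<in> R"
  shows "s \<in> power_span y k \<Longrightarrow> b [^] k \<otimes> s \<in> power_span (b \<otimes> y) k"
proof (induction k arbitrary: s)
  case 0 thus ?case by simp
next
  case (Suc k)
  have b: "b \<in> carrier S" using assms by simp
  obtain n c where s: "n \<in> power_span y k" "c \<in> R" "s = n \<oplus> c \<otimes> y [^] Suc k"
    using Suc(2) by (rule power_span_SucE)
  have "b [^] Suc k \<otimes> s = b \<otimes> (b [^] k \<otimes> n) \<oplus> c \<otimes> (b [^] Suc k \<otimes> y [^] Suc k)"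
    unfolding s(3) nat_pow_Suc
    using power_span_carrier[OF s(1)] base_carrier[OF s(2)] b y nat_pow_closed[OF y, of k]
      nat_pow_closed[OF b, of k] by algebra
  also have "\<dots> = b \<otimes> (b [^] k \<otimes> n) \<oplus> c \<otimes> (b \<otimes> y) [^] Suc k"
    using nat_pow_distrib[OF b y] by metis
  finally show ?case
    using power_span_SucI[OF _ s(2)] length_two_extension.power_span_smult[OF length_two_extension_axioms
      m_closed[OF b y] assms Suc(1)[OF s(1)]] by simp
qed

end

end

section \<open>Three intermediate rings\<close>

text \<open>The three rings are not fixed as parameters, since the lemmas are applied to an
  arbitrary atom and two others are then chosen.\<close>

locale three_atoms = length_two_extension S R x for S (structure) and R and x +
  assumes conductor_zero: "\<And>r. \<lbrakk> r \<in> R; \<And>s. s \<in> carrier S \<Longrightarrow> r \<otimes> s \<in> R \<rbrakk> \<Longrightarrow> r = \<zero>"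
    and three: "\<exists>T1 T2 T3. T1 \<in> atoms \<and> T2 \<in> atoms \<and> T3 \<in> atoms \<and> T1 \<noteq> T2 \<and> T1 \<noteq> T3 \<and> T2 \<noteq> T3"
begin

text \<open>Whatever \<open>T\<close> is, at most one of the three given atoms equals it.\<close>

lemma other_atoms:
  obtains U V where "U \<in> atoms" "V \<in> atoms" "T \<noteq> U" "T \<noteq> V" "U \<noteq> V"
  using three by metis

lemma base_minus: "a \<in> R \<Longrightarrow> b \<in> R \<Longrightarrow> a \<ominus> b \<in> R"
  using base_closed(3,5) unfolding a_minus_def by blast

lemma conductor_atom_zero:
  assumes "T \<in> atoms" "r \<in> R" "\<And>t. t \<in> T \<Longrightarrow> r \<otimes> t \<in> R"
  shows "r = \<zero>"
proof -
  obtain U V where "U \<in> atoms" "V \<in> atoms" "T \<noteq> U" "T \<noteq> V" "U \<noteq> V"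
    by (rule other_atoms)
  thus ?thesis using conductor_zero[OF assms(2)] conductor_atom[OF assms(1) _ _ _ _ _ assms(2,3)] by blast
qed

text \<open>This is \<open>T = R + T r\<close>: a nonzero \<open>r\<close> cannot multiply
  \<open>T\<close> into \<open>R\<close>. It serves as a divisibility property of \<open>T\<close>
  modulo \<open>R\<close> throughout the section.\<close>

lemma atom_divisible:
  assumes "T \<in> atoms" "r \<in> R" "r \<noteq> \<zero>" "t \<in> T"
  obtains a t' where "a \<in> R" "t' \<in> T" "t = a \<oplus> t' \<otimes> r"
proof -
  have "adjoin R T r = T" using atom_adjoin_base conductor_atom_zero assms(1-3) by blast
  thus ?thesis using that assms(4) by (metis adjoinE)
qed

text \<open>Dividing by \<open>r\<close> and then by \<open>s\<close> gives
  \<open>T = R + T r s\<close>, which would collapse to \<open>R\<close> if \<open>r s\<close> were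
  zero.\<close>

lemma base_domain:
  assumes "r \<in> R" "s \<in> R" "r \<noteq> \<zero>" "s \<noteq> \<zero>"
  shows "r \<otimes> s \<noteq> \<zero>"
proof
  assume z: "r \<otimes> s = \<zero>"
  obtain T where T: "T \<in> atoms" using three by blast
  obtain t where t: "t \<in> T" "t \<notin> R" using T by (rule atom_proper_elem)
  obtain a t' where a: "a \<in> R" "t' \<in> T" "t = a \<oplus> t' \<otimes> r"
    using T assms(1,3) t(1) by (rule atom_divisible)
  obtain b t'' where b: "b \<in> R" "t'' \<in> T" "t' = b \<oplus> t'' \<otimes> s"
    using T assms(2,4) a(2) by (rule atom_divisible)
  have "t = a \<oplus> b \<otimes> r \<oplus> t'' \<otimes> (r \<otimes> s)"
    unfolding a(3) b(3) using a(1) b(1) assms(1,2)[THEN base_carrier] atom_carrier[OF T b(2)] base_carrier[OF a(1)] base_carrier[OF b(1)]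
    by algebra
  hence "t = a \<oplus> b \<otimes> r" using z a(1) b(1) assms(1) atom_carrier[OF T b(2)] by simp
  thus False using t(2) base_closed(4,5) a(1) b(1) assms(1) by blast
qed

lemma base_nontrivial: "\<one> \<noteq> \<zero>"
proof
  assume "\<one> = \<zero>"
  hence "carrier S = {\<zero>}" using carrier_one_zero by simp
  moreover obtain T where T: "T \<in> atoms" using three by blast
  moreover obtain t where t: "t \<in> T" "t \<notin> R" using T by (rule atom_proper_elem)
  ultimately have "t = \<zero>" using atom_carrier by blast
  thus False using \<open>t \<notin> R\<close> base_closed(1) by simp
qed

section \<open>Fractions of \<open>R\<close> inside \<open>S\<close>\<close>

definition fractions :: "'a set"
  where "fractions = {s \<in> carrier S. \<exists>b\<in>R. b \<noteq> \<zero> \<and> b \<otimes> s \<in> R}"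

text \<open>Products of denominators stay nonzero because \<open>R\<close> is a domain. Being an
  intermediate ring, \<open>fractions\<close> either contains a given atom or meets it in
  \<open>R\<close>.\<close>

lemma fractions_subalgebra: "fractions \<in> subalgebras R S"
proof (rule subalgebraI)
  show "R \<subseteq> fractions"
    using base_closed(2) base_nontrivial unfolding fractions_def by force
  show "subring fractions S"
  proof (rule subringI)
    show "fractions \<subseteq> carrier S" unfolding fractions_def by auto
    show "\<one> \<in> fractions" using \<open>R \<subseteq> fractions\<close> base_closed(2) by auto
    fix s assume "s \<in> fractions"
    then obtain b where b: "s \<in> carrier S" "b \<in> R" "b \<noteq> \<zero>" "b \<otimes> s \<in> R" unfolding fractions_def by blast
    have "b \<otimes> \<ominus> s = \<ominus> (b \<otimes> s)" using b by (simp add: r_minus)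
    thus "\<ominus> s \<in> fractions" using b base_closed(3)[OF b(4)] unfolding fractions_def by auto
    fix t assume "t \<in> fractions"
    then obtain c where c: "t \<in> carrier S" "c \<in> R" "c \<noteq> \<zero>" "c \<otimes> t \<in> R" unfolding fractions_def by blast
    have bc: "b \<otimes> c \<in> R" "b \<otimes> c \<noteq> \<zero>" using base_closed(4) base_domain b c by blast+
    note cl = b(1) c(1) base_carrier[OF b(2)] base_carrier[OF c(2)]
    have "(b \<otimes> c) \<otimes> (s \<otimes> t) = (b \<otimes> s) \<otimes> (c \<otimes> t)" using cl by algebra
    also have "\<dots> \<in> R" by (rule base_closed(4)[OF b(4) c(4)])
    finally show "s \<otimes> t \<in> fractions" using bc cl unfolding fractions_def by auto
    have "(b \<otimes> c) \<otimes> (s \<oplus> t) = c \<otimes> (b \<otimes> s) \<oplus> b \<otimes> (c \<otimes> t)" using cl by algebra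
    also have "\<dots> \<in> R" by (intro base_closed b c)
    finally show "s \<oplus> t \<in> fractions" using bc cl unfolding fractions_def by auto
  qed
qed

text \<open>
  The hypothesis \<open>H\<close> below says that \<open>t\<close> is a root of no nonconstant polynomial over \<open>R\<close> with nonzero
  leading coefficient.
\<close>

lemma transcendental_mult_base:
  assumes t: "t \<in> carrier S"
    and H: "\<And>b m. b \<in> R \<Longrightarrow> b \<noteq> \<zero> \<Longrightarrow> b \<otimes> t [^] Suc m \<notin> power_span t m"
  shows "g \<in> power_span t k \<Longrightarrow> g \<otimes> t \<in> R \<Longrightarrow> g = \<zero>"
proof (induction k arbitrary: g)
  case 0
  thus ?case using H[of g 0] t by auto
next
  case (Suc k)
  obtain n c where g: "n \<in> power_span t k" "c \<in> R" "g = n \<oplus> c \<otimes> t [^] Suc k"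
    using Suc(2) by (rule power_span_SucE)
  note cl = power_span_carrier[OF t g(1)] base_carrier[OF g(2)] t nat_pow_closed[OF t, of "Suc k"]
  have "c \<otimes> (t [^] Suc k \<otimes> t) = g \<otimes> t \<ominus> n \<otimes> t"
    unfolding g(3) using cl by algebra
  hence "c \<otimes> t [^] Suc (Suc k) = g \<otimes> t \<ominus> n \<otimes> t" by simp
  also have "\<dots> \<in> power_span t (Suc k)"
    using power_span_diff[OF t base_power_span[OF t Suc(3)] power_span_mult[OF t g(1)]] .
  finally have "c = \<zero>" using H g(2) by blast
  hence "g = n" using g(3) cl by simp
  thus ?case using Suc(1,3) g(1) by simp
qed

text \<open>Comparing top coefficients: \<open>H\<close> forces \<open>r \<otimes> c\<close> to
  vanish, and then \<open>c\<close> vanishes since \<open>R\<close> is a domain. So scaling by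
  \<open>r\<close> cannot make a nonconstant expression constant.\<close>

lemma transcendental_smult_base:
  assumes t: "t \<in> carrier S"
    and H: "\<And>b m. b \<in> R \<Longrightarrow> b \<noteq> \<zero> \<Longrightarrow> b \<otimes> t [^] Suc m \<notin> power_span t m"
    and r: "r \<in> R" "r \<noteq> \<zero>"
  shows "g \<in> power_span t k \<Longrightarrow> r \<otimes> g \<in> R \<Longrightarrow> g \<in> R"
proof (induction k arbitrary: g)
  case 0 thus ?case by simp
next
  case (Suc k)
  obtain n c where g: "n \<in> power_span t k" "c \<in> R" "g = n \<oplus> c \<otimes> t [^] Suc k"
    using Suc(2) by (rule power_span_SucE)
  note cl = power_span_carrier[OF t g(1)] base_carrier[OF g(2)] base_carrier[OF r(1)]
    t nat_pow_closed[OF t, of "Suc k"]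
  have "(r \<otimes> c) \<otimes> t [^] Suc k = r \<otimes> g \<ominus> r \<otimes> n"
    unfolding g(3) using cl by algebra
  also have "\<dots> \<in> power_span t k"
    using power_span_diff[OF t base_power_span[OF t Suc(3)] power_span_smult[OF t r(1) g(1)]] .
  finally have "r \<otimes> c = \<zero>" using H base_closed(4)[OF r(1) g(2)] by blast
  hence "c = \<zero>" using base_domain r g(2) by blast
  hence "g = n" using g(3) cl by simp
  thus ?case using Suc(1,3) g(1) by simp
qed

text \<open>A determinant-free Nakayama argument. Using \<open>T = R + T r\<close>, a factor of the
  form \<open>1 - r d\<close> is found that multiplies \<open>T\<close> into ever shorter spans.
  Once it multiplies \<open>T\<close> into \<open>R\<close>, it lies in the conductor and is
  zero.\<close>

lemma atom_nakayama:
  assumes T: "T \<in> atoms" and r: "r \<in> R" "r \<noteq> \<zero>" and y: "y \<in> T" and span: "T \<subseteq> power_span y m"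
  shows "\<exists>d\<in>R. r \<otimes> d = \<one>"
proof -
  have yc: "y \<in> carrier S" using atom_carrier[OF T y] .
  note T' = subringE[OF atom_subring[OF T]]
  have rc: "r \<in> carrier S" using r by simp
  \<comment> \<open>The induction descends from \<open>m\<close> to \<open>0\<close>, eliminating
    one power of \<open>y\<close> at a time.\<close>
  have "0 \<le> m" by simp
  hence "\<exists>d\<in>R. \<forall>v\<in>T. (\<one> \<ominus> r \<otimes> d) \<otimes> v \<in> power_span y 0"
  proof (induction rule: inc_induct)
    case base
    have "\<forall>v\<in>T. (\<one> \<ominus> r \<otimes> \<zero>) \<otimes> v \<in> power_span y m"
      using span rc atom_carrier[OF T] by (auto simp: a_minus_def)
    thus ?case using base_closed(1) by blast
  next
    case (step k)
    then obtain d where d: "d \<in> R" "\<And>v. v \<in> T \<Longrightarrow> (\<one> \<ominus> r \<otimes> d) \<otimes> v \<in> power_span y (Suc k)" by blast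
    let ?a = "\<one> \<ominus> r \<otimes> d"
    let ?p = "y [^] Suc k"
    have aR: "?a \<in> R" by (intro base_minus base_closed(2,4) d(1) r(1))
    have pT: "?p \<in> T" 
    proof -
      have "y [^] j \<in> T" for j :: nat by (induction j) (use T'(3,6) y in auto)
      thus ?thesis .
    qed
    obtain c0 t where t: "c0 \<in> R" "t \<in> T" "?p = c0 \<oplus> t \<otimes> r"
      using T r pT by (rule atom_divisible)
    obtain n' d' where n': "n' \<in> power_span y k" "d' \<in> R" "?a \<otimes> t = n' \<oplus> d' \<otimes> ?p"
      using d(2)[OF t(2)] by (rule power_span_SucE)
    note cl = base_carrier[OF aR] rc base_carrier[OF d(1)] base_carrier[OF t(1)] atom_carrier[OF T t(2)]
      power_span_carrier[OF yc n'(1)] base_carrier[OF n'(2)] atom_carrier[OF T pT]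
    \<comment> \<open>Chosen so that \<open>1 - r ?d\<close> is the product of \<open>?a\<close> and
      \<open>?a - r d'\<close>: the first factor brings \<open>T\<close> into the span up to
      \<open>Suc k\<close>, the second brings the top power into the span up to
      \<open>k\<close>.\<close>
    let ?d = "d \<oplus> (d \<oplus> d') \<ominus> r \<otimes> (d \<otimes> (d \<oplus> d'))"
    have key: "(?a \<ominus> r \<otimes> d') \<otimes> ?p \<in> power_span y k"
    proof -
      have "?a \<otimes> ?p = ?a \<otimes> c0 \<oplus> r \<otimes> (?a \<otimes> t)"
        by (subst t(3)) (use cl in algebra)
      also have "\<dots> = ?a \<otimes> c0 \<oplus> r \<otimes> n' \<oplus> (r \<otimes> d') \<otimes> ?p"
        unfolding n'(3) using cl by algebra
      finally have ap: "?a \<otimes> ?p = ?a \<otimes> c0 \<oplus> r \<otimes> n' \<oplus> (r \<otimes> d') \<otimes> ?p" .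
      have "(?a \<ominus> r \<otimes> d') \<otimes> ?p = ?a \<otimes> ?p \<ominus> (r \<otimes> d') \<otimes> ?p"
        using cl(1,2,7,8) by (simp add: a_minus_def l_distr l_minus)
      also have "\<dots> = ?a \<otimes> c0 \<oplus> r \<otimes> n'"
        unfolding ap using cl by algebra
      also have "\<dots> \<in> power_span y k"
        by (rule power_span_add[OF yc base_power_span[OF yc base_closed(4)[OF aR t(1)]] power_span_smult[OF yc r(1) n'(1)]])
      finally show ?thesis .
    qed
    have eR: "?a \<ominus> r \<otimes> d' \<in> R" by (rule base_minus[OF aR base_closed(4)[OF r(1) n'(2)]])
    have "d \<oplus> d' \<in> R" by (rule base_closed(5)[OF d(1) n'(2)])
    hence "?d \<in> R" by (intro base_minus base_closed(4,5) d(1) r(1) n'(2))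
    moreover have "(\<one> \<ominus> r \<otimes> ?d) \<otimes> v \<in> power_span y k" if v: "v \<in> T" for v
    proof -
      obtain n c where n: "n \<in> power_span y k" "c \<in> R" "?a \<otimes> v = n \<oplus> c \<otimes> ?p"
        using d(2)[OF v] by (rule power_span_SucE)
      note cl' = power_span_carrier[OF yc n(1)] base_carrier[OF n(2)] base_carrier[OF eR] atom_carrier[OF T v]
      have "\<one> \<ominus> r \<otimes> ?d = (?a \<ominus> r \<otimes> d') \<otimes> ?a" using cl by algebra
      hence "(\<one> \<ominus> r \<otimes> ?d) \<otimes> v = (?a \<ominus> r \<otimes> d') \<otimes> (?a \<otimes> v)" using cl cl' by (simp add: m_assoc)
      also have "\<dots> = (?a \<ominus> r \<otimes> d') \<otimes> n \<oplus> c \<otimes> ((?a \<ominus> r \<otimes> d') \<otimes> ?p)"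
        unfolding n(3) using cl' cl(8) by algebra
      also have "\<dots> \<in> power_span y k"
        by (rule power_span_add[OF yc power_span_smult[OF yc eR n(1)] power_span_smult[OF yc n(2) key]])
      finally show ?thesis .
    qed
    ultimately show ?case by blast
  qed
  then obtain d where d: "d \<in> R" "\<And>v. v \<in> T \<Longrightarrow> (\<one> \<ominus> r \<otimes> d) \<otimes> v \<in> R" by auto
  have "\<one> \<ominus> r \<otimes> d \<in> R" by (intro base_minus base_closed(2,4) d(1) r(1))
  hence "\<one> \<ominus> r \<otimes> d = \<zero>" using conductor_atom_zero[OF T] d(2) by blast
  thus ?thesis using d(1) rc by (intro bexI[of _ d]) auto
qed

text \<open>By minimality \<open>T\<close> meets \<open>fractions\<close> in \<open>R\<close>, so
  nonzero multiples of an element of \<open>T\<close> outside \<open>R\<close> stay outside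
  \<open>R\<close> and still generate \<open>T\<close>. If such a \<open>t\<close> is algebraic, a
  multiple is integral and Nakayama applies. Otherwise \<open>t\<close> lies in
  \<open>R[r t]\<close>, and comparing polynomials in \<open>t\<close> inverts
  \<open>r\<close>.\<close>

lemma base_field_of_not_fraction:
  assumes T: "T \<in> atoms" and nf: "\<not> T \<subseteq> fractions" and r: "r \<in> R" "r \<noteq> \<zero>"
  shows "\<exists>d\<in>R. r \<otimes> d = \<one>"
proof -
  have TF: "fractions \<inter> T = R"
    using atom_minimal[OF T subalgebra_inter[OF fractions_subalgebra atom_subalgebra[OF T]]] nf by blast
  have frac: "s \<in> R" if "b \<in> R" "b \<noteq> \<zero>" "s \<in> T" "b \<otimes> s \<in> R" for b s
    using that TF atom_carrier[OF T] unfolding fractions_def by blast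
  note T' = subringE[OF atom_subring[OF T]]
  have rc: "r \<in> carrier S" using r by simp
  obtain t where t: "t \<in> T" "t \<notin> R" using T by (rule atom_proper_elem)
  have tc: "t \<in> carrier S" using atom_carrier T t by blast
  have scaled: "b \<otimes> t \<in> T" "b \<otimes> t \<notin> R" if "b \<in> R" "b \<noteq> \<zero>" for b
    using that frac t T'(6) atom_base[OF T] by blast+
  show ?thesis
  proof (cases "\<exists>b\<in>R. \<exists>m. b \<noteq> \<zero> \<and> b \<otimes> t [^] Suc m \<in> power_span t m")
    case True
    \<comment> \<open>Multiplying the relation by \<open>b [^] m\<close> makes it monic in
      \<open>b \<otimes> t\<close>.\<close>
    then obtain b m where b: "b \<in> R" "b \<noteq> \<zero>" "b \<otimes> t [^] Suc m \<in> power_span t m" by blast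
    have bc: "b \<in> carrier S" using b by simp
    have "(b \<otimes> t) [^] Suc m = b [^] Suc m \<otimes> t [^] Suc m" by (rule nat_pow_distrib[OF bc tc])
    also have "\<dots> = b [^] m \<otimes> (b \<otimes> t [^] Suc m)" using bc tc by (simp add: m_assoc)
    also have "\<dots> \<in> power_span (b \<otimes> t) m" by (rule power_span_clear_denominator[OF tc b(1,3)])
    finally have "simple_extension R (b \<otimes> t) \<subseteq> power_span (b \<otimes> t) m"
      using simple_extension_integral bc tc by blast
    hence "T \<subseteq> power_span (b \<otimes> t) m" using atom_simple_extension[OF T scaled[OF b(1,2)]] by simp
    thus ?thesis using atom_nakayama[OF T r scaled(1)[OF b(1,2)]] by blast
  next
    case False
    hence H: "\<And>b m. b \<in> R \<Longrightarrow> b \<noteq> \<zero> \<Longrightarrow> b \<otimes> t [^] Suc m \<notin> power_span t m" by blast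
    \<comment> \<open>The outermost Horner step of \<open>t\<close> as a polynomial in
      \<open>r t\<close> yields \<open>t = n r t + c\<close>, so that \<open>(1 - r n) t\<close> is
      the constant \<open>c\<close>.\<close>
    have "t \<in> simple_extension R (r \<otimes> t)" using atom_simple_extension[OF T scaled[OF r]] t by simp
    then obtain n c where n: "n \<in> simple_extension R (r \<otimes> t)" "c \<in> R" "t = n \<otimes> (r \<otimes> t) \<oplus> c"
      using t(2) base_closed(1) by (cases rule: simple_extension.cases) auto
    have nT: "n \<in> T" using n(1) atom_simple_extension[OF T scaled[OF r]] by simp
    have nc: "n \<in> carrier S" using atom_carrier T nT by blast
    have gT: "\<one> \<ominus> r \<otimes> n \<in> T"
      unfolding a_minus_def
      by (rule T'(7)[OF T'(3) T'(5)[OF T'(6)[OF subsetD[OF atom_base[OF T] r(1)] nT]]])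
    obtain k where k: "\<one> \<ominus> r \<otimes> n \<in> power_span t k"
      using simple_extension_power_span[OF tc] gT atom_simple_extension[OF T t] by blast
    have "(\<one> \<ominus> r \<otimes> n) \<otimes> t = t \<ominus> n \<otimes> (r \<otimes> t)" using nc rc tc by algebra
    also have "\<dots> = n \<otimes> (r \<otimes> t) \<oplus> c \<ominus> n \<otimes> (r \<otimes> t)"
      by (rule arg_cong[OF n(3), where f = "\<lambda>s. s \<ominus> n \<otimes> (r \<otimes> t)"])
    also have "\<dots> = c" using nc rc tc base_carrier[OF n(2)] by algebra
    finally have "\<one> \<ominus> r \<otimes> n = \<zero>" using transcendental_mult_base[OF tc H k] n(2) by simp
    hence rn: "r \<otimes> n = \<one>" using nc rc by simp
    \<comment> \<open>The inverse \<open>n\<close> is so far only in \<open>T\<close>; as a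
      polynomial in \<open>t\<close> with \<open>r n\<close> constant, it must itself be
      constant.\<close>
    obtain j where "n \<in> power_span t j"
      using simple_extension_power_span[OF tc] nT atom_simple_extension[OF T t] by blast
    hence "n \<in> R" using transcendental_smult_base[OF tc H r] rn base_closed(2) by simp
    thus ?thesis using rn by blast
  qed
qed

section \<open>Atoms consisting of fractions\<close>

lemma atom_fraction_normalise:
  assumes T: "T \<in> atoms" and b: "b \<in> R" "b \<noteq> \<zero>" and u: "u \<in> T" "b \<otimes> u \<in> R"
  obtains e u' where "e \<in> R" "u' \<in> T" "u = e \<oplus> u' \<otimes> b" "b \<otimes> (u' \<otimes> b) \<in> R"
proof -
  obtain e u' where e: "e \<in> R" "u' \<in> T" "u = e \<oplus> u' \<otimes> b"
    using T b u(1) by (rule atom_divisible)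
  \<comment> \<open>After subtracting a constant from \<open>u\<close>, the remainder is a
    \<open>b\<close>-multiple in \<open>T\<close> and still has denominator
    \<open>b\<close>.\<close>
  have "b \<otimes> (u' \<otimes> b) = b \<otimes> u \<ominus> b \<otimes> e"
    unfolding e(3) using base_carrier[OF b(1)] base_carrier[OF e(1)] atom_carrier[OF T e(2)] by algebra
  also have "\<dots> \<in> R" by (rule base_minus[OF u(2) base_closed(4)[OF b(1) e(1)]])
  finally show ?thesis using that e by blast
qed

text \<open>One factor \<open>b\<close> can be moved to either side. Then \<open>b\<close> clears
  the other element into \<open>R\<close>, so the product lies in \<open>T\<close> as well as in
  \<open>U\<close>.\<close>

lemma atoms_normalised_prod:
  assumes "T \<in> atoms" "U \<in> atoms" "T \<noteq> U" "b \<in> R" "u \<in> T" "w \<in> U"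
    and "b \<otimes> (u \<otimes> b) \<in> R" "b \<otimes> (w \<otimes> b) \<in> R"
  shows "(u \<otimes> b) \<otimes> (w \<otimes> b) \<in> R"
proof -
  note cl = base_carrier[OF assms(4)] atom_carrier[OF assms(1,5)] atom_carrier[OF assms(2,6)]
  have "(u \<otimes> b) \<otimes> (w \<otimes> b) = u \<otimes> (b \<otimes> (w \<otimes> b))" using cl by algebra
  also have "\<dots> \<in> T"
    using subringE(6)[OF atom_subring[OF assms(1)] assms(5)] atom_base[OF assms(1)] assms(8) by blast
  finally have 1: "(u \<otimes> b) \<otimes> (w \<otimes> b) \<in> T" .
  have "(u \<otimes> b) \<otimes> (w \<otimes> b) = w \<otimes> (b \<otimes> (u \<otimes> b))" using cl by algebra
  also have "\<dots> \<in> U"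
    using subringE(6)[OF atom_subring[OF assms(2)] assms(6)] atom_base[OF assms(2)] assms(7) by blast
  finally show ?thesis using 1 atoms_inter[OF assms(1-3)] by blast
qed

lemma common_denominator:
  assumes "u \<in> fractions" "w \<in> fractions"
  obtains b where "b \<in> R" "b \<noteq> \<zero>" "b \<otimes> u \<in> R" "b \<otimes> w \<in> R"
proof -
  obtain c where c: "u \<in> carrier S" "c \<in> R" "c \<noteq> \<zero>" "c \<otimes> u \<in> R"
    using assms(1) unfolding fractions_def by blast
  obtain d where d: "w \<in> carrier S" "d \<in> R" "d \<noteq> \<zero>" "d \<otimes> w \<in> R"
    using assms(2) unfolding fractions_def by blast
  note cl = c(1) d(1) base_carrier[OF c(2)] base_carrier[OF d(2)]
  have "(c \<otimes> d) \<otimes> u = d \<otimes> (c \<otimes> u)" "(c \<otimes> d) \<otimes> w = c \<otimes> (d \<otimes> w)" using cl by algebra+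
  thus ?thesis using that[of "c \<otimes> d"] base_domain base_closed(4) c d by simp
qed

text \<open>\<open>S\<close> is spanned by products \<open>t u\<close>. With a common denominator,
  both factors are a constant plus a normalised part; the product of the normalised parts lies in
  \<open>R\<close>, and every other term lies in \<open>T\<close> or \<open>U\<close>.\<close>

lemma fraction_atoms_sum:
  assumes T: "T \<in> atoms" "T \<subseteq> fractions" and U: "U \<in> atoms" "U \<subseteq> fractions" and "T \<noteq> U"
    and s: "s \<in> carrier S"
  obtains t u where "t \<in> T" "u \<in> U" "s = t \<oplus> u"
proof -
  have split: "\<exists>p\<in>T. \<exists>q\<in>U. t \<otimes> u = p \<oplus> q" if tu: "t \<in> T" "u \<in> U" for t u
  proof -
    obtain b where b: "b \<in> R" "b \<noteq> \<zero>" "b \<otimes> t \<in> R" "b \<otimes> u \<in> R"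
      using common_denominator T(2) U(2) tu by blast
    obtain e t' where e: "e \<in> R" "t' \<in> T" "t = e \<oplus> t' \<otimes> b" "b \<otimes> (t' \<otimes> b) \<in> R"
      using T(1) b(1,2) tu(1) b(3) by (rule atom_fraction_normalise)
    obtain f u' where f: "f \<in> R" "u' \<in> U" "u = f \<oplus> u' \<otimes> b" "b \<otimes> (u' \<otimes> b) \<in> R"
      using U(1) b(1,2) tu(2) b(4) by (rule atom_fraction_normalise)
    have pr: "(t' \<otimes> b) \<otimes> (u' \<otimes> b) \<in> R"
      using atoms_normalised_prod[OF T(1) U(1) assms(5) b(1) e(2) f(2) e(4) f(4)] .
    note cl = base_carrier[OF b(1)] base_carrier[OF e(1)] base_carrier[OF f(1)]
      atom_carrier[OF T(1) e(2)] atom_carrier[OF U(1) f(2)]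
    have "t \<otimes> u = (e \<otimes> f \<oplus> (t' \<otimes> b) \<otimes> (u' \<otimes> b) \<oplus> f \<otimes> (t' \<otimes> b)) \<oplus> e \<otimes> (u' \<otimes> b)"
      unfolding e(3) f(3) using cl by algebra
    moreover have "e \<otimes> f \<oplus> (t' \<otimes> b) \<otimes> (u' \<otimes> b) \<oplus> f \<otimes> (t' \<otimes> b) \<in> T"
      by (intro subringE(6,7)[OF atom_subring[OF T(1)]] e(2) subsetD[OF atom_base[OF T(1)] e(1)]
          subsetD[OF atom_base[OF T(1)] f(1)] subsetD[OF atom_base[OF T(1)] b(1)] subsetD[OF atom_base[OF T(1)] pr])
    moreover have "e \<otimes> (u' \<otimes> b) \<in> U"
      by (intro subringE(6)[OF atom_subring[OF U(1)]] f(2) subsetD[OF atom_base[OF U(1)] e(1)]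
          subsetD[OF atom_base[OF U(1)] b(1)])
    ultimately show ?thesis by blast
  qed
  have "s \<in> ideal_prod S T U" using s join_eq_ideal_prod[OF T(1) U(1) assms(5)] by simp
  hence "\<exists>p\<in>T. \<exists>q\<in>U. s = p \<oplus> q"
  proof (induction rule: ideal_prod.induct)
    case (prod i j) thus ?case by (rule split)
  next
    case (sum s1 s2)
    then obtain p q p' q' where pq: "p \<in> T" "q \<in> U" "s1 = p \<oplus> q" "p' \<in> T" "q' \<in> U" "s2 = p' \<oplus> q'" by blast
    have "s1 \<oplus> s2 = (p \<oplus> p') \<oplus> (q \<oplus> q')"
      unfolding pq(3,6) using atom_carrier[OF T(1) pq(1)] atom_carrier[OF T(1) pq(4)]
        atom_carrier[OF U(1) pq(2)] atom_carrier[OF U(1) pq(5)] by algebra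
    thus ?case using subringE(7)[OF atom_subring[OF T(1)] pq(1,4)] subringE(7)[OF atom_subring[OF U(1)] pq(2,5)]
      by blast
  qed
  thus ?thesis using that by blast
qed

text \<open>Otherwise an element of \<open>T1\<close> is a sum of elements of \<open>T2\<close> and
  \<open>T3\<close>. After normalisation its products with both summands lie in \<open>R\<close>, so
  it satisfies a monic quadratic equation. Then \<open>T1\<close> is \<open>R + R ?t\<close>, and
  \<open>b\<close> multiplies it into \<open>R\<close>, contrary to the zero conductor.\<close>

lemma exists_not_fraction: "\<exists>T\<in>atoms. \<not> T \<subseteq> fractions"
proof (rule ccontr)
  assume "\<not> ?thesis"
  hence frac: "\<And>T. T \<in> atoms \<Longrightarrow> T \<subseteq> fractions" by blast
  obtain T1 T2 T3 where T: "T1 \<in> atoms" "T2 \<in> atoms" "T3 \<in> atoms" "T1 \<noteq> T2" "T1 \<noteq> T3" "T2 \<noteq> T3"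
    using three by blast
  obtain t where t: "t \<in> T1" "t \<notin> R" using T(1) by (rule atom_proper_elem)
  have tc: "t \<in> carrier S" using atom_carrier T(1) t by blast
  obtain w z where wz: "w \<in> T2" "z \<in> T3" "t = w \<oplus> z"
    using T(2) frac[OF T(2)] T(3) frac[OF T(3)] T(6) tc by (rule fraction_atoms_sum)
  obtain b where b: "b \<in> R" "b \<noteq> \<zero>" "b \<otimes> t \<in> R" "b \<otimes> w \<in> R"
    by (rule common_denominator[OF subsetD[OF frac[OF T(1)] t(1)] subsetD[OF frac[OF T(2)] wz(1)]])
  note wc = atom_carrier[OF T(2) wz(1)] and zc = atom_carrier[OF T(3) wz(2)] and bc = base_carrier[OF b(1)]
  have "b \<otimes> z = b \<otimes> t \<ominus> b \<otimes> w" unfolding wz(3) using wc zc bc by algebra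
  also have "\<dots> \<in> R" by (rule base_minus[OF b(3,4)])
  finally have bz: "b \<otimes> z \<in> R" .
  obtain e t' where e: "e \<in> R" "t' \<in> T1" "t = e \<oplus> t' \<otimes> b" "b \<otimes> (t' \<otimes> b) \<in> R"
    using T(1) b(1,2) t(1) b(3) by (rule atom_fraction_normalise)
  obtain f w' where f: "f \<in> R" "w' \<in> T2" "w = f \<oplus> w' \<otimes> b" "b \<otimes> (w' \<otimes> b) \<in> R"
    using T(2) b(1,2) wz(1) b(4) by (rule atom_fraction_normalise)
  obtain g z' where g: "g \<in> R" "z' \<in> T3" "z = g \<oplus> z' \<otimes> b" "b \<otimes> (z' \<otimes> b) \<in> R"
    using T(3) b(1,2) wz(2) bz by (rule atom_fraction_normalise)
  let ?t = "t' \<otimes> b" and ?w = "w' \<otimes> b" and ?z = "z' \<otimes> b"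
  have tw: "?t \<otimes> ?w \<in> R" and tz: "?t \<otimes> ?z \<in> R"
    using atoms_normalised_prod[OF T(1,2,4) b(1) e(2) f(2) e(4) f(4)]
      atoms_normalised_prod[OF T(1,3,5) b(1) e(2) g(2) e(4) g(4)] by auto
  note cl = base_carrier[OF e(1)] base_carrier[OF f(1)] base_carrier[OF g(1)] bc
    atom_carrier[OF T(1) e(2)] atom_carrier[OF T(2) f(2)] atom_carrier[OF T(3) g(2)]
  let ?c = "f \<oplus> g \<ominus> e"
  have cR: "?c \<in> R" by (rule base_minus[OF base_closed(5)[OF f(1) g(1)] e(1)])
  \<comment> \<open>The normalised parts satisfy the same sum relation up to the constant
    \<open>?c\<close>; multiplying it by \<open>?t\<close> gives the quadratic equation.\<close>
  have t'': "?t = ?w \<oplus> ?z \<oplus> ?c"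
  proof -
    have "?t = t \<ominus> e" unfolding e(3) using cl by algebra
    also have "\<dots> = ?w \<oplus> ?z \<oplus> ?c" unfolding wz(3) f(3) g(3) using cl by algebra
    finally show ?thesis .
  qed
  have tt: "?t \<in> carrier S" using cl by simp
  have sq: "?t \<otimes> ?t = (?t \<otimes> ?w \<oplus> ?t \<otimes> ?z) \<oplus> ?c \<otimes> ?t"
  proof -
    have "?t \<otimes> ?t = ?t \<otimes> (?w \<oplus> ?z \<oplus> ?c)" using t'' by simp
    thus ?thesis using tt cl base_carrier[OF cR] by (simp add: r_distr m_comm)
  qed
  have v: "?t \<otimes> ?w \<oplus> ?t \<otimes> ?z \<in> R" using base_closed(5) tw tz by blast
  have "subring (adjoin R R ?t) S"
    using adjoin_subring[OF subring_base subring_base order_refl tt cR base_carrier[OF v] sq]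
      base_closed(4) v by blast
  note sub = subalgebraI[OF this adjoin_incl(1)[OF subring_base subring_base tt]]
  have tT: "?t \<in> T1" using subringE(6)[OF atom_subring[OF T(1)] e(2)] atom_base[OF T(1)] b(1) by blast
  have "adjoin R R ?t \<subseteq> T1"
    using subringE(6,7)[OF atom_subring[OF T(1)]] atom_base[OF T(1)] tT unfolding adjoin_def by blast
  moreover have "?t \<notin> R" using t(2) e(1,3) base_closed(5) by blast
  hence "adjoin R R ?t \<noteq> R" using adjoin_incl(3)[OF subring_base subring_base tt] by blast
  ultimately have T1: "adjoin R R ?t = T1" using atom_minimal[OF T(1) sub] by blast
  have "b \<otimes> s \<in> R" if s: "s \<in> T1" for s
  proof -
    obtain p q where pq: "p \<in> R" "q \<in> R" "s = p \<oplus> q \<otimes> ?t"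
      using s unfolding T1[symmetric] by (rule adjoinE)
    have "b \<otimes> s = b \<otimes> p \<oplus> q \<otimes> (b \<otimes> ?t)"
      unfolding pq(3) using bc base_carrier[OF pq(1)] base_carrier[OF pq(2)] tt by algebra
    also have "\<dots> \<in> R" by (rule base_closed(5)[OF base_closed(4)[OF b(1) pq(1)] base_closed(4)[OF pq(2) e(4)]])
    finally show ?thesis .
  qed
  thus False using conductor_atom_zero[OF T(1) b(1)] b(2) by blast
qed

lemma base_inverse: "r \<in> R \<Longrightarrow> r \<noteq> \<zero> \<Longrightarrow> \<exists>d\<in>R. r \<otimes> d = \<one>"
  using exists_not_fraction base_field_of_not_fraction by blast

end

section \<open>Subfields of a simple field extension\<close>

text \<open>Principal ideals stand for divisors up to units. Write \<open>f = q g\<close> with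
  \<open>q\<close> irreducible, hence prime, and let \<open>p h = f\<close>. Either \<open>q\<close>
  divides \<open>p\<close> and the quotient divides \<open>g\<close>, or \<open>q\<close> divides
  \<open>h\<close> and \<open>p\<close> divides \<open>g\<close>. Thus the ideals for
  \<open>f\<close> arise from those for \<open>g\<close>, directly or multiplied by
  \<open>q\<close>.\<close>

lemma (in field) finite_divisor_ideals:
  assumes "f \<in> carrier (poly_ring R)" "f \<noteq> []"
  shows "finite {PIdl\<^bsub>poly_ring R\<^esub> p | p. p \<in> carrier (poly_ring R) \<and> p pdivides f}"
  using assms
proof (induction "degree f" arbitrary: f rule: less_induct)
  case less
  interpret UP: principal_domain "poly_ring R"
    using univ_poly_is_principal[OF carrier_is_subfield] .
  define D where "D f = {PIdl\<^bsub>poly_ring R\<^esub> p | p. p \<in> carrier (poly_ring R) \<and> p pdivides f}" for f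
  have D_I: "PIdl\<^bsub>poly_ring R\<^esub> p \<in> D f" if "p \<in> carrier (poly_ring R)" "p pdivides f" for p f
    using that unfolding D_def by blast
  have D_E: "\<exists>p. I = PIdl\<^bsub>poly_ring R\<^esub> p \<and> p \<in> carrier (poly_ring R) \<and> p pdivides f" if "I \<in> D f" for I f
    using that unfolding D_def by simp
  have "finite (D f)"
  proof (cases "f \<in> Units (poly_ring R)")
    case True
    have "D f \<subseteq> {carrier (poly_ring R)}"
    proof
      fix I assume "I \<in> D f"
      then obtain p where p: "I = PIdl\<^bsub>poly_ring R\<^esub> p" "p \<in> carrier (poly_ring R)" "p pdivides f"
        using D_E by blast
      hence "p \<in> Units (poly_ring R)" using UP.divides_unit[of p f] True unfolding pdivides_def by blast
      thus "I \<in> {carrier (poly_ring R)}" using UP.ideal_eq_carrier_iff[OF p(2)] p(1) by simp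
    qed
    thus ?thesis using finite_subset by blast
  next
    case False
    have "f \<in> carrier (poly_ring R) - {\<zero>\<^bsub>poly_ring R\<^esub>}"
      using less.prems by (simp add: univ_poly_zero)
    then obtain q where q: "q \<in> carrier (poly_ring R)" "pirreducible (carrier R) q" "q divides\<^bsub>poly_ring R\<^esub> f"
      using False by (rule UP.exists_irreducible_divisor)
    obtain g where g: "g \<in> carrier (poly_ring R)" "f = q \<otimes>\<^bsub>poly_ring R\<^esub> g"
      using q(3) unfolding factor_def by blast
    have q0: "q \<noteq> []" using pirreducibleE(1)[OF carrier_is_subring q(1,2)] .
    have g0: "g \<noteq> []"
    proof
      assume "g = []"
      hence "f = []" using g(2) UP.r_null[OF q(1)] by (simp add: univ_poly_zero)
      thus False using less.prems(2) by simp
    qed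
    have "degree f = degree q + degree g"
      using poly_mult_degree_eq[OF carrier_is_subring] q(1) g q0 g0
      unfolding univ_poly_mult univ_poly_carrier by simp
    hence "degree g < degree f"
      using pirreducible_degree[OF carrier_is_subfield q(1,2)] by linarith
    hence fin: "finite (D g)" using less.hyps[OF _ g(1) g0] unfolding D_def by blast
    have prime: "pprime (carrier R) q" using pprime_iff_pirreducible[OF carrier_is_subfield q(1)] q(2) by simp
    have "D f \<subseteq> D g \<union> (\<lambda>I. (\<lambda>s. q \<otimes>\<^bsub>poly_ring R\<^esub> s) ` I) ` D g"
    proof
      fix I assume "I \<in> D f"
      then obtain p where p: "I = PIdl\<^bsub>poly_ring R\<^esub> p" "p \<in> carrier (poly_ring R)" "p pdivides f"
        using D_E by blast
      then obtain h where h: "h \<in> carrier (poly_ring R)" "f = p \<otimes>\<^bsub>poly_ring R\<^esub> h"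
        unfolding pdivides_def factor_def by blast
      have "q pdivides (p \<otimes>\<^bsub>poly_ring R\<^esub> h)" using q(3) h(2) unfolding pdivides_def by simp
      then consider "q pdivides p" | "q pdivides h"
        using pprimeE(3)[OF carrier_is_subfield q(1) prime p(2) h(1)] by blast
      thus "I \<in> D g \<union> (\<lambda>I. (\<lambda>s. q \<otimes>\<^bsub>poly_ring R\<^esub> s) ` I) ` D g"
      proof cases
        case 1
        then obtain p' where p': "p' \<in> carrier (poly_ring R)" "p = q \<otimes>\<^bsub>poly_ring R\<^esub> p'"
          unfolding pdivides_def factor_def by blast
        have "q \<otimes>\<^bsub>poly_ring R\<^esub> g = q \<otimes>\<^bsub>poly_ring R\<^esub> (p' \<otimes>\<^bsub>poly_ring R\<^esub> h)"
          using g(2) h(2) p' q(1) h(1) by (simp add: UP.m_assoc)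
        hence "g = p' \<otimes>\<^bsub>poly_ring R\<^esub> h"
          using UP.m_lcancel[OF _ q(1) g(1), of "p' \<otimes>\<^bsub>poly_ring R\<^esub> h"] q0 p'(1) h(1) by (simp add: univ_poly_zero)
        hence "p' pdivides g" using h(1) unfolding pdivides_def factor_def by blast
        hence "PIdl\<^bsub>poly_ring R\<^esub> p' \<in> D g" using D_I[OF p'(1)] by blast
        moreover have "I = (\<lambda>s. q \<otimes>\<^bsub>poly_ring R\<^esub> s) ` (PIdl\<^bsub>poly_ring R\<^esub> p')"
        proof -
          have "s \<otimes>\<^bsub>poly_ring R\<^esub> (q \<otimes>\<^bsub>poly_ring R\<^esub> p') = q \<otimes>\<^bsub>poly_ring R\<^esub> (s \<otimes>\<^bsub>poly_ring R\<^esub> p')"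
            if "s \<in> carrier (poly_ring R)" for s
            using that q(1) p'(1) UP.m_lcomm by blast
          thus ?thesis unfolding p(1) p'(2) cgenideal_def by (auto simp: image_iff) (metis+)
        qed
        ultimately show ?thesis by blast
      next
        case 2
        then obtain h' where h': "h' \<in> carrier (poly_ring R)" "h = q \<otimes>\<^bsub>poly_ring R\<^esub> h'"
          unfolding pdivides_def factor_def by blast
        have "q \<otimes>\<^bsub>poly_ring R\<^esub> g = q \<otimes>\<^bsub>poly_ring R\<^esub> (p \<otimes>\<^bsub>poly_ring R\<^esub> h')"
          using g(2) h(2) h' q(1) p(2) by (simp add: UP.m_lcomm)
        hence "g = p \<otimes>\<^bsub>poly_ring R\<^esub> h'"
          using UP.m_lcancel[OF _ q(1) g(1), of "p \<otimes>\<^bsub>poly_ring R\<^esub> h'"] q0 p(2) h'(1) by (simp add: univ_poly_zero)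
        hence "p pdivides g" using h'(1) unfolding pdivides_def factor_def by blast
        thus ?thesis using D_I[OF p(2)] p(1) by blast
      qed
    qed
    thus ?thesis using fin finite_subset by blast
  qed
  thus ?case unfolding D_def .
qed

text \<open>A nonzero ideal of \<open>K[X]\<close> has only one monic generator. This makes counting
  ideals the same as counting minimal polynomials.\<close>

lemma (in domain) monic_cgenideal_inj:
  assumes "subfield K R" "p \<in> carrier (K[X])" "q \<in> carrier (K[X])"
    and "lead_coeff p = \<one>" "lead_coeff q = \<one>" "p \<noteq> []" "PIdl\<^bsub>K[X]\<^esub> p = PIdl\<^bsub>K[X]\<^esub> q"
  shows "p = q"
proof -
  interpret UP: principal_domain "K[X]"
    using univ_poly_is_principal[OF assms(1)] .
  have "p \<in> PIdl\<^bsub>K[X]\<^esub> p" using UP.cgenideal_self[OF assms(2)] .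
  hence "PIdl\<^bsub>K[X]\<^esub> p \<noteq> {[]}" using assms(6) by auto
  from exists_unique_gen[OF assms(1) UP.cgenideal_ideal[OF assms(2)] this]
  show ?thesis using assms by blast
qed

text \<open>Steinitz's argument, adapted to fields meeting pairwise in \<open>K\<close>. If two of
  them gave the same minimal polynomial of \<open>x\<close>, its coefficients would lie in
  \<open>K\<close>, and division by it would show that \<open>T\<close> is no larger than
  \<open>K\<close>.\<close>

lemma (in field) finite_subfields_inter:
  assumes K: "subfield K R" and x: "x \<in> carrier R" "simple_extension K x = carrier R" "(algebraic over K) x"
    and sub: "\<And>T. T \<in> F \<Longrightarrow> subfield T R" "\<And>T. T \<in> F \<Longrightarrow> K \<subset> T"
    and inter: "\<And>T U. T \<in> F \<Longrightarrow> U \<in> F \<Longrightarrow> T \<noteq> U \<Longrightarrow> T \<inter> U = K"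
  shows "finite F"
proof -
  have sr: "subring T R" if "T \<in> F" for T using subfieldE(1)[OF sub(1)[OF that]] .
  have alg: "(algebraic over T) x" if "T \<in> F" for T
    using x(3) transcendental_mono[of K T x] sub(2)[OF that] unfolding over_def by blast
  have irr: "Irr T x \<in> carrier (T[X])" "pirreducible T (Irr T x)" "lead_coeff (Irr T x) = \<one>"
    "eval (Irr T x) x = \<zero>" if "T \<in> F" for T
    using IrrE[OF sub(1)[OF that] x(1) alg[OF that]] .
  note irrK = IrrE[OF K x(1,3)]
  have Irr_carrier: "Irr T x \<in> carrier (poly_ring R)" if "T \<in> F" for T
    using carrier_polynomial_shell[OF sr[OF that] irr(1)[OF that]] .
  have Irr_neq: "Irr T x \<noteq> []" if "T \<in> F" for T
    using pirreducible_degree[OF sub(1)[OF that] irr(1,2)[OF that]] by fastforce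
  have mono: "p \<in> carrier (T[X])" if "T \<in> F" "p \<in> carrier (K[X])" for T p
    using that sub(2) unfolding univ_poly_def polynomial_def by fastforce
  have Irr_inj: "T = U" if TU: "T \<in> F" "U \<in> F" and eq: "Irr T x = Irr U x" for T U
  proof (rule ccontr)
    assume "T \<noteq> U"
    define p where "p = Irr T x"
    have "p \<in> carrier (T[X])" "p \<in> carrier (U[X])"
      using irr(1)[OF TU(1)] irr(1)[OF TU(2)] eq unfolding p_def by auto
    hence pK: "p \<in> carrier (K[X])"
      using inter[OF TU \<open>T \<noteq> U\<close>] unfolding univ_poly_def polynomial_def by auto
    have p0: "p \<noteq> []" "eval p x = \<zero>" "degree p \<ge> 1"
      using Irr_neq[OF TU(1)] irr(4)[OF TU(1)] pirreducible_degree[OF sub(1)[OF TU(1)] irr(1,2)[OF TU(1)]]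
      unfolding p_def by blast+
    obtain t where t: "t \<in> T" "t \<notin> K" using sub(2)[OF TU(1)] by blast
    have tR: "t \<in> carrier R" using subringE(1)[OF sr[OF TU(1)]] t(1) by blast
    have t0: "t \<noteq> \<zero>" using t(2) subringE(2)[OF subfieldE(1)[OF K]] by blast
    have "t \<in> (\<lambda>p. eval p x) ` carrier (K[X])"
      using tR x(2) simple_extension_as_eval_img[OF subfieldE(3)[OF K] x(1)] by simp
    then obtain q where q: "q \<in> carrier (K[X])" "eval q x = t" by blast
    \<comment> \<open>Since \<open>x\<close> is a root of \<open>p\<close>, the remainder still
      takes the value \<open>t\<close> at \<open>x\<close>.\<close>
    define r where "r = q pmod p"
    have r: "r \<in> carrier (K[X])" "q pdiv p \<in> carrier (K[X])"
      using long_division_closed[OF K q(1) pK] unfolding r_def by auto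
    interpret EV: ring_hom_ring "K[X]" R "\<lambda>p. eval p x"
      using eval_ring_hom[OF subfieldE(1)[OF K] x(1)] .
    have "q = p \<otimes>\<^bsub>K[X]\<^esub> (q pdiv p) \<oplus>\<^bsub>K[X]\<^esub> r"
      using pdiv_pmod[OF K q(1) pK] unfolding r_def .
    hence "eval q x = eval (p \<otimes>\<^bsub>K[X]\<^esub> (q pdiv p) \<oplus>\<^bsub>K[X]\<^esub> r) x" by simp
    hence er: "eval r x = t"
      using EV.hom_add EV.hom_mult pK r p0(2) q(2) by simp
    have "r \<noteq> []" using er t0 by auto
    hence degr: "degree r < degree p" using pmod_degree[OF K q(1) pK p0(1)] unfolding r_def by blast
    interpret UT: domain "T[X]" using univ_poly_is_domain[OF sr[OF TU(1)]] .
    interpret ET: ring_hom_ring "T[X]" R "\<lambda>p. eval p x"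
      using eval_ring_hom[OF sr[OF TU(1)] x(1)] .
    have rT: "r \<in> carrier (T[X])" using mono TU(1) r(1) by blast
    have mt: "\<ominus> t \<in> T" "\<ominus> t \<noteq> \<zero>"
      using subringE(5)[OF sr[OF TU(1)] t(1)] minus_minus[OF tR] minus_zero t0 by auto
    have cT: "[\<ominus> t] \<in> carrier (T[X])"
      using mt unfolding univ_poly_def polynomial_def by auto
    \<comment> \<open>This is \<open>r - t\<close> over \<open>T\<close>: it vanishes at
      \<open>x\<close> but has smaller degree than the minimal polynomial \<open>p\<close>, so it is
      zero and \<open>r\<close> is the constant \<open>t\<close>.\<close>
    define h where "h = r \<oplus>\<^bsub>T[X]\<^esub> [\<ominus> t]"
    have hT: "h \<in> carrier (T[X])" unfolding h_def using rT cT by simp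
    have eh: "eval h x = \<zero>"
      unfolding h_def using ET.hom_add[OF rT cT] er tR x(1) by (simp add: r_neg)
    have pd: "p pdivides h"
      using Irr_minimal[OF sub(1)[OF TU(1)] x(1) alg[OF TU(1)] hT eh] unfolding p_def .
    have "degree h \<le> max (degree r) 0"
      using poly_add_degree[of r "[\<ominus> t]"] unfolding h_def univ_poly_add by simp
    hence "degree h < degree p" using degr by simp
    hence h0: "h = []"
      using pdivides_imp_degree_le[OF sr[OF TU(1)] \<open>p \<in> carrier (T[X])\<close> hT _ pd] by fastforce
    have "r = \<ominus>\<^bsub>T[X]\<^esub> [\<ominus> t]"
      using h0 rT cT UT.minus_equality[of r "[\<ominus> t]"] unfolding h_def by (simp add: univ_poly_zero)
    also have "\<dots> = [t]"
      using univ_poly_a_inv_def'[OF sr[OF TU(1)] cT] tR by simp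
    finally have "t \<in> K" using r(1) unfolding univ_poly_def polynomial_def by auto
    thus False using t(2) by simp
  qed
  let ?I = "\<lambda>T. PIdl\<^bsub>poly_ring R\<^esub> (Irr T x)"
  have "inj_on ?I F"
  proof (rule inj_onI)
    fix T U assume TU: "T \<in> F" "U \<in> F" "?I T = ?I U"
    have "Irr T x = Irr U x"
      by (rule monic_cgenideal_inj[OF carrier_is_subfield Irr_carrier[OF TU(1)] Irr_carrier[OF TU(2)]
            irr(3)[OF TU(1)] irr(3)[OF TU(2)] Irr_neq[OF TU(1)] TU(3)])
    thus "T = U" using Irr_inj TU by blast
  qed
  moreover have "?I ` F \<subseteq> {PIdl\<^bsub>poly_ring R\<^esub> p | p. p \<in> carrier (poly_ring R) \<and> p pdivides (Irr K x)}"
  proof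
    fix I assume "I \<in> ?I ` F"
    then obtain T where T: "T \<in> F" "I = ?I T" by blast
    have "Irr T x pdivides Irr K x"
      using Irr_minimal[OF sub(1)[OF T(1)] x(1) alg[OF T(1)] mono[OF T(1) irrK(1)] irrK(4)] .
    thus "I \<in> {PIdl\<^bsub>poly_ring R\<^esub> p | p. p \<in> carrier (poly_ring R) \<and> p pdivides (Irr K x)}"
      using Irr_carrier[OF T(1)] T(2) by blast
  qed
  moreover have K0: "Irr K x \<noteq> []" using pirreducible_degree[OF K irrK(1,2)] by fastforce
  have "finite {PIdl\<^bsub>poly_ring R\<^esub> p | p. p \<in> carrier (poly_ring R) \<and> p pdivides (Irr K x)}"
    by (rule finite_divisor_ideals[OF carrier_polynomial_shell[OF subfieldE(1)[OF K] irrK(1)] K0])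
  ultimately show ?thesis by (meson finite_subset finite_imageD)
qed

text \<open>For \<open>x\<close> nonzero, the inverse of \<open>x\<close> is a value
  \<open>q(x)\<close>, so \<open>x\<close> is a root of \<open>X q - 1\<close>.\<close>

lemma (in field) simple_extension_imp_algebraic:
  assumes K: "subfield K R" and x: "x \<in> carrier R" "simple_extension K x = carrier R"
  shows "(algebraic over K) x"
proof (cases "x = \<zero>")
  case True thus ?thesis using zero_is_algebraic[OF subfieldE(1)[OF K]] by simp
next
  case False
  hence ix: "inv x \<in> carrier R" "inv x \<otimes> x = \<one>" using field_Units x(1) by auto
  have "inv x \<in> (\<lambda>p. eval p x) ` carrier (K[X])"
    using ix(1) x(2) simple_extension_as_eval_img[OF subfieldE(3)[OF K] x(1)] by simp
  then obtain q where "inv x = eval q x" and q1: "q \<in> carrier (K[X])" by (rule imageE)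
  hence q: "q \<in> carrier (K[X])" "eval q x = inv x" by simp_all
  have q0: "q \<noteq> []"
  proof
    assume "q = []"
    hence "inv x = \<zero>" using q(2) by simp
    thus False using ix(2) x(1) by simp
  qed
  have K1: "\<ominus> \<one> \<in> K"
    by (rule subringE(5)[OF subfieldE(1)[OF K] subringE(3)[OF subfieldE(1)[OF K]]])
  \<comment> \<open>Coefficient lists start with the leading coefficient, so appending
    \<open>\<ominus> \<one>\<close> multiplies by \<open>X\<close> and subtracts one.\<close>
  have "q @ [\<ominus> \<one>] \<in> carrier (K[X])"
    using q(1) q0 K1 unfolding univ_poly_def polynomial_def by auto
  moreover have "eval (q @ [\<ominus> \<one>]) x = \<zero>"
  proof -
    have "set q \<subseteq> carrier R"
      using q(1) subfieldE(3)[OF K] unfolding univ_poly_def polynomial_def by auto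
    thus ?thesis using eval_append_aux[of q "\<ominus> \<one>" x] q(2) ix x(1) by (simp add: r_neg)
  qed
  ultimately show ?thesis using algebraicI[of "q @ [\<ominus> \<one>]" K x] unfolding over_def by auto
qed

section \<open>Extensions of a field\<close>

text \<open>For a nonzero nonunit \<open>t\<close>, the ring \<open>K + T t^2\<close> is
  \<open>K\<close> or \<open>T\<close>. In the first case \<open>t^2\<close> is a nonunit in the
  field \<open>K\<close>, hence zero. In the second, \<open>t = a + u t^2\<close> forces
  \<open>a\<close> to vanish and \<open>u t\<close> to be idempotent. The lemma is applied both to
  an atom over \<open>R\<close> and to \<open>S\<close> over an atom.\<close>

lemma (in cring) minimal_over_field_cases:
  assumes K: "subring K R" and T: "subring T R" "K \<subseteq> T"
    and inverse: "\<And>a. a \<in> K \<Longrightarrow> a \<noteq> \<zero> \<Longrightarrow> \<exists>b\<in>K. a \<otimes> b = \<one>"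
    and minimal: "\<And>A. subring A R \<Longrightarrow> K \<subseteq> A \<Longrightarrow> A \<subseteq> T \<Longrightarrow> A = K \<or> A = T"
    and t: "t \<in> T" "t \<noteq> \<zero>" "\<And>u. u \<in> T \<Longrightarrow> t \<otimes> u \<noteq> \<one>"
  obtains e where "e \<in> T" "e \<notin> K" "e \<otimes> e = \<zero> \<or> e \<otimes> e = e"
proof -
  note T' = subringE[OF T(1)] and K' = subringE[OF K]
  have Tc: "\<And>s. s \<in> T \<Longrightarrow> s \<in> carrier R" using T'(1) by auto
  have tc: "t \<in> carrier R" using Tc t(1) .
  have tK: "t \<notin> K" using inverse t T(2) by blast
  let ?A = "adjoin K T (t \<otimes> t)"
  have tt: "t \<otimes> t \<in> T" using T'(6) t(1) by blast
  have "subring ?A R" by (rule adjoin_subring'[OF K T(1,2) Tc[OF tt] tt refl])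
  moreover have "K \<subseteq> ?A" by (rule adjoin_incl(1)[OF K T(1) Tc[OF tt]])
  moreover have "?A \<subseteq> T"
  proof
    fix s assume "s \<in> ?A"
    then obtain a u where "a \<in> K" "u \<in> T" "s = a \<oplus> u \<otimes> (t \<otimes> t)" by (rule adjoinE)
    thus "s \<in> T" using T'(7)[OF subsetD[OF T(2)] T'(6)[OF _ tt]] by simp
  qed
  ultimately consider "?A = K" | "?A = T" using minimal by blast
  thus ?thesis
  proof cases
    case 1
    hence "t \<otimes> t \<in> K" using adjoin_incl(3)[OF K T(1) Tc[OF tt]] by simp
    moreover have "t \<otimes> (t \<otimes> b) \<noteq> \<one>" if "b \<in> K" for b
      using t(3)[OF T'(6)[OF t(1) subsetD[OF T(2) that]]] .
    ultimately have "t \<otimes> t = \<zero>"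
      using inverse[of "t \<otimes> t"] K'(1) tc by (metis m_assoc subsetD)
    thus ?thesis using that t(1) tK by blast
  next
    case 2
    have "t \<in> ?A" using 2 t(1) by simp
    then obtain a u where au: "a \<in> K" "u \<in> T" "t = a \<oplus> u \<otimes> (t \<otimes> t)" by (rule adjoinE)
    have ac: "a \<in> carrier R" and uc: "u \<in> carrier R" using K'(1) au(1) Tc au(2) by auto
    have aeq: "a = t \<otimes> (\<one> \<ominus> u \<otimes> t)"
    proof -
      have "t \<otimes> (\<one> \<ominus> u \<otimes> t) = t \<ominus> u \<otimes> (t \<otimes> t)" using tc uc by algebra
      also have "\<dots> = (a \<oplus> u \<otimes> (t \<otimes> t)) \<ominus> u \<otimes> (t \<otimes> t)"
        by (rule arg_cong[OF au(3), where f = "\<lambda>s. s \<ominus> u \<otimes> (t \<otimes> t)"])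
      also have "\<dots> = a" using tc uc ac by algebra
      finally show ?thesis by simp
    qed
    \<comment> \<open>By \<open>aeq\<close> this element of \<open>K\<close> is a multiple of
      \<open>t\<close>; an inverse of it would invert \<open>t\<close>.\<close>
    have "a = \<zero>"
    proof (rule ccontr)
      assume "a \<noteq> \<zero>"
      then obtain b where b: "b \<in> K" "a \<otimes> b = \<one>" using inverse au(1) by blast
      have bT: "b \<in> T" using T(2) b(1) by blast
      have w: "\<one> \<ominus> u \<otimes> t \<in> T"
        unfolding a_minus_def by (rule T'(7)[OF T'(3) T'(5)[OF T'(6)[OF au(2) t(1)]]])
      have "t \<otimes> ((\<one> \<ominus> u \<otimes> t) \<otimes> b) = (t \<otimes> (\<one> \<ominus> u \<otimes> t)) \<otimes> b"
        using tc Tc[OF w] Tc[OF bT] by (simp add: m_assoc)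
      also have "\<dots> = \<one>" using aeq b(2) by simp
      finally show False using t(3)[OF T'(6)[OF w bT]] by blast
    qed
    hence tu: "t = u \<otimes> (t \<otimes> t)" using au(3) tc uc by simp
    have ut: "u \<otimes> t \<in> T" by (rule T'(6)[OF au(2) t(1)])
    have "(u \<otimes> t) \<otimes> (u \<otimes> t) = u \<otimes> (u \<otimes> (t \<otimes> t))" using tc uc by algebra
    hence idem: "(u \<otimes> t) \<otimes> (u \<otimes> t) = u \<otimes> t" using tu by simp
    have "u \<otimes> t \<notin> K"
    proof
      assume "u \<otimes> t \<in> K"
      moreover have "u \<otimes> t \<noteq> \<zero>"
      proof
        assume "u \<otimes> t = \<zero>"
        moreover have "u \<otimes> (t \<otimes> t) = (u \<otimes> t) \<otimes> t" using tc uc by algebra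
        ultimately show False using tu t(2) tc by simp
      qed
      ultimately obtain b where b: "b \<in> K" "(u \<otimes> t) \<otimes> b = \<one>" using inverse by blast
      have bT: "b \<in> T" using T(2) b(1) by blast
      have "t \<otimes> (u \<otimes> b) = (u \<otimes> t) \<otimes> b" using tc uc Tc[OF bT] by algebra
      thus False using t(3)[OF T'(6)[OF au(2) bT]] b(2) by simp
    qed
    thus ?thesis using that[OF ut] idem by blast
  qed
qed

locale length_two_over_field = length_two_extension S R x for S (structure) and R and x +
  assumes base_inverse: "\<And>r. r \<in> R \<Longrightarrow> r \<noteq> \<zero> \<Longrightarrow> \<exists>d\<in>R. r \<otimes> d = \<one>"
    and base_nontrivial: "\<one> \<noteq> \<zero>"
begin

section \<open>Linear algebra over the field \<open>R\<close> and atoms with square-zero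
  elements\<close>

lemma base_smult_zero:
  assumes "r \<in> R" "s \<in> carrier S" "r \<otimes> s = \<zero>" "r \<noteq> \<zero>"
  shows "s = \<zero>"
proof -
  obtain d where d: "d \<in> R" "r \<otimes> d = \<one>" using base_inverse assms by blast
  have "s = d \<otimes> (r \<otimes> s)"
    using d assms(1,2) m_assoc[of d r s] m_comm[of d r] by simp
  thus ?thesis using assms(3) d(1) by simp
qed

lemma adjoin_subalgebra:
  assumes "subring T S" "R \<subseteq> T" "e \<in> carrier S" "u \<in> T" "e \<otimes> e = u \<otimes> e"
  shows "adjoin R T e \<in> subalgebras R S"
  by (rule subalgebraI[OF adjoin_subring'[OF subring_base assms] adjoin_incl(1)[OF subring_base assms(1,3)]])

lemma adjoin_eq_atom:
  assumes T: "T \<in> atoms" and e: "e \<in> T" "e \<notin> R" and u: "u \<in> R" "e \<otimes> e = u \<otimes> e"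
  shows "adjoin R R e = T"
proof -
  have ec: "e \<in> carrier S" using atom_carrier T e(1) .
  note T' = subringE[OF atom_subring[OF T]]
  have "adjoin R R e \<subseteq> T"
  proof
    fix s assume "s \<in> adjoin R R e"
    then obtain a t where "a \<in> R" "t \<in> R" "s = a \<oplus> t \<otimes> e" by (rule adjoinE)
    thus "s \<in> T" using T'(7)[OF subsetD[OF atom_base[OF T]] T'(6)[OF subsetD[OF atom_base[OF T]] e(1)]] by simp
  qed
  thus ?thesis
    using atom_minimal[OF T adjoin_subalgebra[OF subring_base order_refl ec u]]
      adjoin_incl(3)[OF subring_base subring_base ec] e(2) by blast
qed

text \<open>\<open>T + T e f\<close> is a ring, hence \<open>T\<close> or \<open>S\<close>. In the
  latter case, writing \<open>f\<close> in it and multiplying by \<open>e\<close> gives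
  \<open>e f = \<alpha> e\<close>; multiplying by \<open>f\<close> gives
  \<open>\<alpha>^2 e = 0\<close>, so \<open>e f\<close> vanishes anyway.\<close>

lemma nilpotent_prod_mem:
  assumes T: "T \<in> atoms" and e: "e \<in> T" "e \<notin> R" "e \<otimes> e = \<zero>" and f: "f \<in> carrier S" "f \<otimes> f = \<zero>"
  shows "e \<otimes> f \<in> T"
proof -
  note Ts = atom_subring[OF T] and Tc = atom_carrier[OF T]
  have ec: "e \<in> carrier S" using Tc e(1) .
  have cc: "e \<otimes> f \<in> carrier S" using ec f(1) by simp
  have ecz: "e \<otimes> (e \<otimes> f) = \<zero>" using e(3) ec f(1) by (simp flip: m_assoc)
  have cfz: "(e \<otimes> f) \<otimes> f = \<zero>" using f ec by (simp add: m_assoc)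
  have cz: "(e \<otimes> f) \<otimes> (e \<otimes> f) = \<zero> \<otimes> (e \<otimes> f)"
  proof -
    have "(e \<otimes> f) \<otimes> (e \<otimes> f) = (e \<otimes> (e \<otimes> f)) \<otimes> f" using ec f(1) by algebra
    thus ?thesis using ecz f(1) cc by simp
  qed
  let ?A = "adjoin T T (e \<otimes> f)"
  have "subring ?A S" by (rule adjoin_subring'[OF Ts Ts order_refl cc subringE(2)[OF Ts] cz])
  note incl = adjoin_incl[OF Ts Ts cc]
  have "?A \<in> subalgebras R S" using subalgebraI[OF \<open>subring ?A S\<close>] incl(1) atom_base[OF T] by blast
  then consider "?A = T" | "?A = carrier S" using atom_maximal[OF T _ incl(1)] by blast
  thus ?thesis
  proof cases
    case 1 thus ?thesis using incl(3) by simp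
  next
    case 2
    have "f \<in> ?A" using 2 f(1) by simp
    then obtain a t where at: "a \<in> T" "t \<in> T" "f = a \<oplus> t \<otimes> (e \<otimes> f)" by (rule adjoinE)
    have "a \<in> adjoin R R e" using adjoin_eq_atom[OF T e(1,2) base_closed(1)] e(3) ec at(1) by simp
    then obtain \<alpha> \<beta> where ab: "\<alpha> \<in> R" "\<beta> \<in> R" "a = \<alpha> \<oplus> \<beta> \<otimes> e" by (rule adjoinE)
    note cl = ec f(1) Tc[OF at(2)] base_carrier[OF ab(1)] base_carrier[OF ab(2)]
    have "e \<otimes> f = e \<otimes> (a \<oplus> t \<otimes> (e \<otimes> f))" by (rule arg_cong[OF at(3)])
    also have "\<dots> = \<alpha> \<otimes> e \<oplus> \<beta> \<otimes> (e \<otimes> e) \<oplus> t \<otimes> (e \<otimes> (e \<otimes> f))"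
      unfolding ab(3) using cl by algebra
    also have "\<dots> = \<alpha> \<otimes> e" unfolding e(3) ecz using cl by simp
    finally have c: "e \<otimes> f = \<alpha> \<otimes> e" .
    have "\<alpha> \<otimes> (\<alpha> \<otimes> e) = \<alpha> \<otimes> (e \<otimes> f)" using c by simp
    also have "\<dots> = (\<alpha> \<otimes> e) \<otimes> f" using cl by algebra
    also have "\<dots> = \<zero>" using c cfz by simp
    finally have "\<alpha> \<otimes> (\<alpha> \<otimes> e) = \<zero>" .
    hence "\<alpha> = \<zero> \<or> e = \<zero>"
      using base_smult_zero[OF ab(1) m_closed[OF base_carrier[OF ab(1)] ec]] base_smult_zero[OF ab(1) ec] by blast
    hence "e \<otimes> f = \<zero>" using c cl e(2) base_closed(1) by auto
    thus ?thesis using subringE(2)[OF Ts] by simp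
  qed
qed

text \<open>If the atoms differed, \<open>e f\<close> would lie in \<open>R\<close> and annihilate
  \<open>e\<close>, hence be zero. The generator \<open>x\<close> would then be a constant plus a
  square-zero \<open>n\<close>, so \<open>S = R + R n\<close>. As \<open>n\<close> annihilates
  \<open>e\<close> and \<open>f\<close>, both would be multiples of \<open>n\<close>, and
  \<open>f\<close> would lie in \<open>T\<close>.\<close>

lemma nilpotent_atoms_eq:
  assumes T: "T \<in> atoms" "e \<in> T" "e \<notin> R" "e \<otimes> e = \<zero>"
    and U: "U \<in> atoms" "f \<in> U" "f \<notin> R" "f \<otimes> f = \<zero>"
  shows "T = U"
proof (rule ccontr)
  assume neq: "T \<noteq> U"
  note TU = atoms_inter[OF T(1) U(1) neq]
  have ec: "e \<in> carrier S" and fc: "f \<in> carrier S" using atom_carrier T(1,2) U(1,2) by blast+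
  have "e \<otimes> f \<in> T" "e \<otimes> f \<in> U"
    using nilpotent_prod_mem[OF T fc U(4)] nilpotent_prod_mem[OF U ec T(4)] m_comm[OF ec fc] by auto
  hence "e \<otimes> f \<in> R" using TU by blast
  moreover have "(e \<otimes> f) \<otimes> e = (e \<otimes> e) \<otimes> f" using ec fc by algebra
  hence "(e \<otimes> f) \<otimes> e = \<zero>" using T(4) fc by simp
  moreover have "e \<noteq> \<zero>" "f \<noteq> \<zero>" using T(3) U(3) base_closed(1) by auto
  ultimately have efz: "e \<otimes> f = \<zero>" using base_smult_zero[OF _ ec] by blast
  note Ts = atom_subring[OF T(1)]
  let ?A = "adjoin T T f"
  have "subring ?A S"
    by (rule adjoin_subring'[OF Ts Ts order_refl fc subringE(2)[OF Ts]]) (use U(4) fc in simp)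
  note incl = adjoin_incl[OF Ts Ts fc]
  have "f \<notin> T" using U(2,3) TU by blast
  hence "?A = carrier S"
    using atom_maximal[OF T(1) subalgebraI[OF \<open>subring ?A S\<close>] incl(1)] incl(1,3) atom_base[OF T(1)] by blast
  hence "x \<in> ?A" using generator_closed by simp
  then obtain a t where at: "a \<in> T" "t \<in> T" "x = a \<oplus> t \<otimes> f" by (rule adjoinE)
  have Teq: "adjoin R R e = T" using adjoin_eq_atom[OF T(1-3) base_closed(1)] T(4) ec by simp
  obtain \<alpha> \<beta> where ab: "\<alpha> \<in> R" "\<beta> \<in> R" "a = \<alpha> \<oplus> \<beta> \<otimes> e"
    using at(1) unfolding Teq[symmetric] by (rule adjoinE)
  obtain \<gamma> \<delta> where cd: "\<gamma> \<in> R" "\<delta> \<in> R" "t = \<gamma> \<oplus> \<delta> \<otimes> e"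
    using at(2) unfolding Teq[symmetric] by (rule adjoinE)
  note cl = ec fc base_carrier[OF ab(1)] base_carrier[OF ab(2)] base_carrier[OF cd(1)] base_carrier[OF cd(2)]
  define n where "n = \<beta> \<otimes> e \<oplus> \<gamma> \<otimes> f"
  have nc: "n \<in> carrier S" unfolding n_def using cl by simp
  have "x = \<alpha> \<oplus> n \<oplus> \<delta> \<otimes> (e \<otimes> f)"
    unfolding at(3) ab(3) cd(3) n_def using cl by algebra
  hence xn: "x = \<alpha> \<oplus> n" using efz cl nc by simp
  have "n \<otimes> e = \<beta> \<otimes> (e \<otimes> e) \<oplus> \<gamma> \<otimes> (e \<otimes> f)" unfolding n_def using cl by algebra
  hence ne: "n \<otimes> e = \<zero>" using T(4) efz cl by simp
  have "n \<otimes> f = \<beta> \<otimes> (e \<otimes> f) \<oplus> \<gamma> \<otimes> (f \<otimes> f)" unfolding n_def using cl by algebra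
  hence nf: "n \<otimes> f = \<zero>" using U(4) efz cl by simp
  have "n \<otimes> n = \<beta> \<otimes> (n \<otimes> e) \<oplus> \<gamma> \<otimes> (n \<otimes> f)"
  proof -
    have "n \<otimes> n = n \<otimes> (\<beta> \<otimes> e \<oplus> \<gamma> \<otimes> f)" using n_def by simp
    also have "\<dots> = \<beta> \<otimes> (n \<otimes> e) \<oplus> \<gamma> \<otimes> (n \<otimes> f)" using cl nc by algebra
    finally show ?thesis .
  qed
  hence nn: "n \<otimes> n = \<zero>" using ne nf cl by simp
  have "adjoin R R n \<in> subalgebras R S"
    using adjoin_subalgebra[OF subring_base order_refl nc base_closed(1)] nn nc by simp
  moreover have "x \<in> adjoin R R n"
    using adjoinI[OF ab(1) base_closed(2), of n] xn nc by simp
  ultimately have Sn: "adjoin R R n = carrier S" by (rule generator)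
  have n0: "n \<noteq> \<zero>"
  proof
    assume "n = \<zero>"
    hence "x \<in> R" using xn ab(1) by simp
    hence "R = carrier S" using generator[OF base_subalgebra] by simp
    thus False using ec T(3) by simp
  qed
  \<comment> \<open>In \<open>R + R n\<close> with \<open>n\<close> nonzero of square zero, the
    annihilator of \<open>n\<close> is \<open>R n\<close>.\<close>
  have mult: "\<exists>\<beta>\<in>R. g = \<beta> \<otimes> n" if gc: "g \<in> carrier S" and gn: "n \<otimes> g = \<zero>" for g
  proof -
    obtain p q where pq: "p \<in> R" "q \<in> R" "g = p \<oplus> q \<otimes> n"
      using gc unfolding Sn[symmetric] by (rule adjoinE)
    have "n \<otimes> g = p \<otimes> n \<oplus> q \<otimes> (n \<otimes> n)"
      unfolding pq(3) using nc base_carrier[OF pq(1)] base_carrier[OF pq(2)] by algebra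
    hence "p \<otimes> n = \<zero>" using gn nn nc pq(1,2) by simp
    hence "p = \<zero>" using base_smult_zero[OF pq(1) nc] n0 by blast
    thus ?thesis using pq nc by auto
  qed
  obtain p where p: "p \<in> R" "e = p \<otimes> n" using mult[OF ec ne] by blast
  obtain q where q: "q \<in> R" "f = q \<otimes> n" using mult[OF fc nf] by blast
  have "p \<noteq> \<zero>" using p(2) \<open>e \<noteq> \<zero>\<close> nc by auto
  then obtain d where d: "d \<in> R" "p \<otimes> d = \<one>" using base_inverse p(1) by blast
  have "(q \<otimes> d) \<otimes> e = q \<otimes> ((p \<otimes> d) \<otimes> n)"
    unfolding p(2) using nc base_carrier[OF p(1)] base_carrier[OF q(1)] base_carrier[OF d(1)] by algebra
  hence "(q \<otimes> d) \<otimes> e = f" using d(2) q(2) nc by simp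
  moreover have "(q \<otimes> d) \<otimes> e \<in> T"
    using subringE(6)[OF Ts subsetD[OF atom_base[OF T(1)] base_closed(4)[OF q(1) d(1)]] T(2)] .
  ultimately show False using \<open>f \<notin> T\<close> by simp
qed

section \<open>Atoms with idempotents\<close>

lemma idempotent_multiple:
  assumes f: "f \<in> carrier S" "f \<otimes> f = f" and s: "s \<in> carrier S" "s \<otimes> s = s"
    and c: "c \<in> R" "s \<otimes> f = c \<otimes> f"
  shows "s \<otimes> f \<in> {\<zero>, f}"
proof (cases "c = \<zero>")
  case True thus ?thesis using c f by simp
next
  case False
  then obtain d where d: "d \<in> R" "c \<otimes> d = \<one>" using base_inverse c(1) by blast
  note cl = f(1) s(1) base_carrier[OF c(1)] base_carrier[OF d(1)]
  have "f = d \<otimes> (c \<otimes> f)"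
    using d(2) cl m_assoc[of d c f] m_comm[of d c] by simp
  hence fs: "f = d \<otimes> (s \<otimes> f)" using c(2) by simp
  \<comment> \<open>An invertible \<open>c\<close> makes \<open>f\<close> a multiple of
    \<open>s\<close>, and the idempotent \<open>s\<close> fixes its multiples.\<close>
  have "s \<otimes> f = s \<otimes> (d \<otimes> (s \<otimes> f))" by (rule arg_cong[OF fs])
  also have "\<dots> = d \<otimes> ((s \<otimes> s) \<otimes> f)" using cl by algebra
  also have "\<dots> = f" using s(2) fs by simp
  finally show ?thesis by simp
qed

text \<open>\<open>S = T + T f\<close> is spanned over \<open>R\<close> by \<open>1\<close>,
  \<open>e\<close>, \<open>f\<close> and \<open>e f\<close>, so every \<open>s\<close> acts on each
  of the four products of \<open>e\<close>, \<open>1 - e\<close> with \<open>f\<close>,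
  \<open>1 - f\<close> as a scalar. For idempotent \<open>s\<close> each component is zero or the
  whole product, leaving at most sixteen choices.\<close>

lemma finite_idempotents:
  assumes T: "T \<in> atoms" "e \<in> T" "e \<notin> R" "e \<otimes> e = e"
    and U: "U \<in> atoms" "f \<in> U" "f \<notin> R" "f \<otimes> f = f" and neq: "T \<noteq> U"
  shows "finite {s \<in> carrier S. s \<otimes> s = s}"
proof -
  note Ts = atom_subring[OF T(1)]
  have ec: "e \<in> carrier S" and fc: "f \<in> carrier S" using atom_carrier T(1,2) U(1,2) by blast+
  let ?A = "adjoin T T f"
  have "subring ?A S"
    by (rule adjoin_subring'[OF Ts Ts order_refl fc subringE(3)[OF Ts]]) (use U(4) fc in simp)
  note incl = adjoin_incl[OF Ts Ts fc]
  have "f \<notin> T" using U(2,3) atoms_inter[OF T(1) U(1) neq] by blast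
  hence A: "?A = carrier S"
    using atom_maximal[OF T(1) subalgebraI[OF \<open>subring ?A S\<close>] incl(1)] incl(1,3) atom_base[OF T(1)] by blast
  have Teq: "adjoin R R e = T" using adjoin_eq_atom[OF T(1-3) base_closed(2)] T(4) ec by simp
  define f1 f2 f3 f4 where fdef: "f1 = e \<otimes> f" "f2 = e \<otimes> (\<one> \<ominus> f)" "f3 = (\<one> \<ominus> e) \<otimes> f"
    "f4 = (\<one> \<ominus> e) \<otimes> (\<one> \<ominus> f)"
  have fcl: "f1 \<in> carrier S" "f2 \<in> carrier S" "f3 \<in> carrier S" "f4 \<in> carrier S"
    unfolding fdef using ec fc by simp_all
  have e1: "e \<otimes> (\<one> \<ominus> e) = \<zero>" and f1z: "f \<otimes> (\<one> \<ominus> f) = \<zero>"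
    using T(4) U(4) ec fc by (simp_all add: a_minus_def r_distr r_minus r_neg)
  have ee: "(\<one> \<ominus> e) \<otimes> (\<one> \<ominus> e) = \<one> \<ominus> e" and ff: "(\<one> \<ominus> f) \<otimes> (\<one> \<ominus> f) = \<one> \<ominus> f"
  proof -
    have "(\<one> \<ominus> e) \<otimes> (\<one> \<ominus> e) = (\<one> \<ominus> e) \<ominus> e \<otimes> (\<one> \<ominus> e)" using ec by algebra
    thus "(\<one> \<ominus> e) \<otimes> (\<one> \<ominus> e) = \<one> \<ominus> e" using e1 ec by (simp add: a_minus_def)
    have "(\<one> \<ominus> f) \<otimes> (\<one> \<ominus> f) = (\<one> \<ominus> f) \<ominus> f \<otimes> (\<one> \<ominus> f)" using fc by algebra
    thus "(\<one> \<ominus> f) \<otimes> (\<one> \<ominus> f) = \<one> \<ominus> f" using f1z fc by (simp add: a_minus_def)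
  qed
  have prod_idem: "(a \<otimes> b) \<otimes> (a \<otimes> b) = a \<otimes> b"
    if "a \<in> carrier S" "b \<in> carrier S" "a \<otimes> a = a" "b \<otimes> b = b" for a b
  proof -
    have "(a \<otimes> b) \<otimes> (a \<otimes> b) = (a \<otimes> a) \<otimes> (b \<otimes> b)" using that(1,2) by algebra
    thus ?thesis using that(3,4) by simp
  qed
  have fi: "f1 \<otimes> f1 = f1" "f2 \<otimes> f2 = f2" "f3 \<otimes> f3 = f3" "f4 \<otimes> f4 = f4"
    unfolding fdef using ec fc T(4) U(4) ee ff by (simp_all add: prod_idem)
  have "{s \<in> carrier S. s \<otimes> s = s} \<subseteq>
    (\<lambda>(a, b, c, d). a \<oplus> b \<oplus> c \<oplus> d) ` ({\<zero>, f1} \<times> {\<zero>, f2} \<times> {\<zero>, f3} \<times> {\<zero>, f4})"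
  proof
    fix s assume "s \<in> {s \<in> carrier S. s \<otimes> s = s}"
    hence s: "s \<in> carrier S" "s \<otimes> s = s" by auto
    obtain a t where at: "a \<in> T" "t \<in> T" "s = a \<oplus> t \<otimes> f"
      using s(1) unfolding A[symmetric] by (rule adjoinE)
    obtain \<alpha> \<beta> where ab: "\<alpha> \<in> R" "\<beta> \<in> R" "a = \<alpha> \<oplus> \<beta> \<otimes> e"
      using at(1) unfolding Teq[symmetric] by (rule adjoinE)
    obtain \<gamma> \<delta> where cd: "\<gamma> \<in> R" "\<delta> \<in> R" "t = \<gamma> \<oplus> \<delta> \<otimes> e"
      using at(2) unfolding Teq[symmetric] by (rule adjoinE)
    note cl = ec fc base_carrier[OF ab(1)] base_carrier[OF ab(2)] base_carrier[OF cd(1)] base_carrier[OF cd(2)]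
    have seq: "s = \<alpha> \<oplus> \<beta> \<otimes> e \<oplus> (\<gamma> \<oplus> \<delta> \<otimes> e) \<otimes> f" using at(3) ab(3) cd(3) by simp
    have 1: "s \<otimes> f1 = (\<alpha> \<oplus> \<beta> \<oplus> \<gamma> \<oplus> \<delta>) \<otimes> f1"
    proof -
      have "s \<otimes> f1 = \<alpha> \<otimes> (e \<otimes> f) \<oplus> \<beta> \<otimes> ((e \<otimes> e) \<otimes> f) \<oplus> \<gamma> \<otimes> (e \<otimes> (f \<otimes> f)) \<oplus> \<delta> \<otimes> ((e \<otimes> e) \<otimes> (f \<otimes> f))"
        unfolding seq fdef using cl by algebra
      also have "\<dots> = (\<alpha> \<oplus> \<beta> \<oplus> \<gamma> \<oplus> \<delta>) \<otimes> f1"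
        unfolding T(4) U(4) fdef using cl by algebra
      finally show ?thesis .
    qed
    have 2: "s \<otimes> f2 = (\<alpha> \<oplus> \<beta>) \<otimes> f2"
    proof -
      \<comment> \<open>The identity is proved for an arbitrary \<open>g\<close>, isolating the
        factor \<open>f \<otimes> g\<close> that vanishes at \<open>g = 1 - f\<close>; the next two
        cases proceed likewise.\<close>
      have "s \<otimes> (e \<otimes> g) = \<alpha> \<otimes> (e \<otimes> g) \<oplus> \<beta> \<otimes> ((e \<otimes> e) \<otimes> g) \<oplus> ((\<gamma> \<oplus> \<delta> \<otimes> e) \<otimes> e) \<otimes> (f \<otimes> g)"
        if "g \<in> carrier S" for g
        unfolding seq using cl that by algebra
      note this[of "\<one> \<ominus> f"]
      also have "\<alpha> \<otimes> (e \<otimes> (\<one> \<ominus> f)) \<oplus> \<beta> \<otimes> ((e \<otimes> e) \<otimes> (\<one> \<ominus> f)) \<oplus> ((\<gamma> \<oplus> \<delta> \<otimes> e) \<otimes> e) \<otimes> (f \<otimes> (\<one> \<ominus> f))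
          = (\<alpha> \<oplus> \<beta>) \<otimes> (e \<otimes> (\<one> \<ominus> f))"
        unfolding T(4) f1z using cl by (simp add: l_distr)
      finally show ?thesis using cl unfolding fdef by simp
    qed
    have 3: "s \<otimes> f3 = (\<alpha> \<oplus> \<gamma>) \<otimes> f3"
    proof -
      have "s \<otimes> (g \<otimes> f) = \<alpha> \<otimes> (g \<otimes> f) \<oplus> \<gamma> \<otimes> (g \<otimes> (f \<otimes> f)) \<oplus> (e \<otimes> g) \<otimes> (\<beta> \<otimes> f \<oplus> \<delta> \<otimes> (f \<otimes> f))"
        if "g \<in> carrier S" for g
        unfolding seq using cl that by algebra
      note this[of "\<one> \<ominus> e"]
      also have "\<alpha> \<otimes> ((\<one> \<ominus> e) \<otimes> f) \<oplus> \<gamma> \<otimes> ((\<one> \<ominus> e) \<otimes> (f \<otimes> f)) \<oplus> (e \<otimes> (\<one> \<ominus> e)) \<otimes> (\<beta> \<otimes> f \<oplus> \<delta> \<otimes> (f \<otimes> f))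
          = (\<alpha> \<oplus> \<gamma>) \<otimes> ((\<one> \<ominus> e) \<otimes> f)"
        unfolding U(4) e1 using cl by (simp add: l_distr)
      finally show ?thesis using cl unfolding fdef by simp
    qed
    have 4: "s \<otimes> f4 = \<alpha> \<otimes> f4"
    proof -
      have "s \<otimes> (g \<otimes> h) = \<alpha> \<otimes> (g \<otimes> h) \<oplus> \<beta> \<otimes> ((e \<otimes> g) \<otimes> h) \<oplus> ((\<gamma> \<oplus> \<delta> \<otimes> e) \<otimes> g) \<otimes> (f \<otimes> h)"
        if "g \<in> carrier S" "h \<in> carrier S" for g h
        unfolding seq using cl that by algebra
      note this[of "\<one> \<ominus> e" "\<one> \<ominus> f"]
      also have "\<alpha> \<otimes> ((\<one> \<ominus> e) \<otimes> (\<one> \<ominus> f)) \<oplus> \<beta> \<otimes> ((e \<otimes> (\<one> \<ominus> e)) \<otimes> (\<one> \<ominus> f))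
          \<oplus> ((\<gamma> \<oplus> \<delta> \<otimes> e) \<otimes> (\<one> \<ominus> e)) \<otimes> (f \<otimes> (\<one> \<ominus> f)) = \<alpha> \<otimes> ((\<one> \<ominus> e) \<otimes> (\<one> \<ominus> f))"
        unfolding e1 f1z using cl by simp
      finally show ?thesis using cl unfolding fdef by simp
    qed
    have "s \<otimes> f1 \<in> {\<zero>, f1}" "s \<otimes> f2 \<in> {\<zero>, f2}" "s \<otimes> f3 \<in> {\<zero>, f3}" "s \<otimes> f4 \<in> {\<zero>, f4}"
      using idempotent_multiple[OF fcl(1) fi(1) s _ 1] idempotent_multiple[OF fcl(2) fi(2) s _ 2]
        idempotent_multiple[OF fcl(3) fi(3) s _ 3] idempotent_multiple[OF fcl(4) fi(4) s _ 4]
        base_closed(5) ab(1,2) cd(1,2) by simp_all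
    hence "(s \<otimes> f1, s \<otimes> f2, s \<otimes> f3, s \<otimes> f4) \<in> {\<zero>, f1} \<times> {\<zero>, f2} \<times> {\<zero>, f3} \<times> {\<zero>, f4}"
      by (intro SigmaI)
    moreover have "s = s \<otimes> f1 \<oplus> s \<otimes> f2 \<oplus> s \<otimes> f3 \<oplus> s \<otimes> f4"
      unfolding fdef using s(1) ec fc by algebra
    hence "s = (\<lambda>(a, b, c, d). a \<oplus> b \<oplus> c \<oplus> d) (s \<otimes> f1, s \<otimes> f2, s \<otimes> f3, s \<otimes> f4)"
      unfolding prod.case .
    ultimately show "s \<in> (\<lambda>(a, b, c, d). a \<oplus> b \<oplus> c \<oplus> d) ` ({\<zero>, f1} \<times> {\<zero>, f2} \<times> {\<zero>, f3} \<times> {\<zero>, f4})"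
      by (rule rev_image_eqI)
  qed
  thus ?thesis by (rule finite_subset) simp
qed

text \<open>A nonunit of \<open>S\<close> would give \<open>e\<close> outside \<open>T\<close> with
  square \<open>0\<close> or \<open>e\<close>. Then \<open>R + R e\<close> and
  \<open>R + T e\<close> are rings, and length two makes them equal or the second one
  \<open>S\<close>. Either way a nonzero element of \<open>T\<close> multiplies \<open>e\<close>
  into \<open>T\<close>, so \<open>e\<close> is in \<open>T\<close>.\<close>

lemma field_of_atom_field:
  assumes T: "T \<in> atoms" and inv: "\<And>t. t \<in> T \<Longrightarrow> t \<noteq> \<zero> \<Longrightarrow> \<exists>u\<in>T. t \<otimes> u = \<one>"
    and s: "s \<in> carrier S" "s \<noteq> \<zero>"
  shows "\<exists>u\<in>carrier S. s \<otimes> u = \<one>"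
proof (rule ccontr)
  assume "\<not> ?thesis"
  hence non: "\<And>u. u \<in> carrier S \<Longrightarrow> s \<otimes> u \<noteq> \<one>" by blast
  note Ts = atom_subring[OF T] and Tc = atom_carrier[OF T] and TR = atom_base[OF T]
  note T' = subringE[OF Ts]
  have min: "A = T \<or> A = carrier S" if "subring A S" "T \<subseteq> A" "A \<subseteq> carrier S" for A
    using atom_maximal[OF T subalgebraI] that TR by blast
  \<comment> \<open>The dichotomy is used one level up, with the field \<open>T\<close> as base and
    \<open>S\<close> minimal over it.\<close>
  obtain e where e: "e \<in> carrier S" "e \<notin> T" "e \<otimes> e = \<zero> \<or> e \<otimes> e = e"
    using minimal_over_field_cases[OF Ts carrier_is_subring T'(1) inv min s non] by blast
  obtain u where u: "u \<in> R" "e \<otimes> e = u \<otimes> e"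
    using e(1,3) base_closed(1,2) by (metis l_null l_one)
  let ?A = "adjoin R T e" and ?B = "adjoin R R e"
  have A: "?A \<in> subalgebras R S" using adjoin_subalgebra[OF Ts TR e(1) _ u(2)] u(1) TR by blast
  have B: "?B \<in> subalgebras R S" using adjoin_subalgebra[OF subring_base order_refl e(1) u] .
  have BA: "?B \<subseteq> ?A" using TR unfolding adjoin_def by blast
  have BR: "?B \<noteq> R" using adjoin_incl(3)[OF subring_base subring_base e(1)] e(2) TR by blast
  obtain t where t: "t \<in> T" "t \<notin> R" using T by (rule atom_proper_elem)
  note tc = Tc[OF t(1)]
  have eT: "e \<in> T" if "p \<in> T" "q \<in> T" "q \<noteq> \<zero>" "q \<otimes> e = p" for p q
  proof -
    obtain w where w: "w \<in> T" "q \<otimes> w = \<one>" using inv \<open>q \<in> T\<close> \<open>q \<noteq> \<zero>\<close> by blast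
    have "w \<otimes> p = (q \<otimes> w) \<otimes> e"
      unfolding \<open>q \<otimes> e = p\<close>[symmetric] using Tc[OF \<open>q \<in> T\<close>] Tc[OF w(1)] e(1) by algebra
    thus ?thesis using w(2) e(1) T'(6)[OF w(1) \<open>p \<in> T\<close>] by simp
  qed
  have minus: "p \<ominus> q \<in> T" if "p \<in> T" "q \<in> T" for p q
    unfolding a_minus_def by (rule T'(7)[OF that(1) T'(5)[OF that(2)]])
  consider "?B = ?A" | "?A = carrier S" using length_two[OF B A BA] BR by blast
  thus False
  proof cases
    case 1
    have "t \<otimes> e \<in> ?B" using 1 adjoin_incl(2)[OF subring_base Ts e(1) t(1)] by simp
    then obtain a c where ac: "a \<in> R" "c \<in> R" "t \<otimes> e = a \<oplus> c \<otimes> e" by (rule adjoinE)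
    have "(t \<ominus> c) \<otimes> e = t \<otimes> e \<ominus> c \<otimes> e" using tc e(1) base_carrier[OF ac(2)] by algebra
    also have "\<dots> = a" unfolding ac(3) using e(1) base_carrier[OF ac(1)] base_carrier[OF ac(2)] by algebra
    finally have "(t \<ominus> c) \<otimes> e = a" .
    moreover have "t \<ominus> c \<noteq> \<zero>" using t(2) ac(2) tc by auto
    ultimately show False using eT[of a "t \<ominus> c"] minus[OF t(1)] ac(1,2) TR e(2) by blast
  next
    case 2
    have "t \<in> ?A" using 2 tc by simp
    then obtain a q where aq: "a \<in> R" "q \<in> T" "t = a \<oplus> q \<otimes> e" by (rule adjoinE)
    have "q \<otimes> e = t \<ominus> a"
      unfolding aq(3) using e(1) base_carrier[OF aq(1)] Tc[OF aq(2)] by algebra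
    moreover have "q \<noteq> \<zero>" using aq t(2) e(1) by auto
    ultimately show False using eT[of "t \<ominus> a" q] minus[OF t(1)] aq(1,2) TR e(2) by blast
  qed
qed

section \<open>Classification of atoms and the count over a field\<close>

lemma atom_cases:
  assumes T: "T \<in> atoms"
  shows "(\<forall>t\<in>T. t \<noteq> \<zero> \<longrightarrow> (\<exists>u\<in>T. t \<otimes> u = \<one>)) \<or> (\<exists>e\<in>T. e \<notin> R \<and> e \<otimes> e = \<zero>) \<or> (\<exists>e\<in>T. e \<notin> R \<and> e \<otimes> e = e)"
proof (rule ccontr)
  assume neg: "\<not> ?thesis"
  then obtain t where t: "t \<in> T" "t \<noteq> \<zero>" "\<And>u. u \<in> T \<Longrightarrow> t \<otimes> u \<noteq> \<one>" by blast
  have min: "A = R \<or> A = T" if "subring A S" "R \<subseteq> A" "A \<subseteq> T" for A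
    using atom_minimal[OF T subalgebraI] that by blast
  obtain e where "e \<in> T" "e \<notin> R" "e \<otimes> e = \<zero> \<or> e \<otimes> e = e"
    using minimal_over_field_cases[OF subring_base atom_subring[OF T] atom_base[OF T] base_inverse min t] by blast
  thus False using neg by blast
qed

text \<open>Once \<open>S\<close> is a field, it has no square-zero elements or idempotents besides
  \<open>0\<close> and \<open>1\<close>, so by \<open>atom_cases\<close> every atom is a field and
  Steinitz's argument applies.\<close>

lemma finite_field_atoms:
  assumes T: "T \<in> atoms" and inv: "\<And>t. t \<in> T \<Longrightarrow> t \<noteq> \<zero> \<Longrightarrow> \<exists>u\<in>T. t \<otimes> u = \<one>"
  shows "finite atoms"
proof -
  have unit: "\<And>s. s \<in> carrier S \<Longrightarrow> s \<noteq> \<zero> \<Longrightarrow> \<exists>u\<in>carrier S. s \<otimes> u = \<one>"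
    using field_of_atom_field[OF T inv] .
  interpret F: field S
  proof (rule cring_fieldI)
    show "Units S = carrier S - {\<zero>}"
    proof
      show "Units S \<subseteq> carrier S - {\<zero>}"
        using base_nontrivial unfolding Units_def by auto
      show "carrier S - {\<zero>} \<subseteq> Units S"
        using unit m_comm unfolding Units_def by fastforce
    qed
  qed
  have subf: "subfield A S" if A: "subring A S" and inv: "\<And>t. t \<in> A \<Longrightarrow> t \<noteq> \<zero> \<Longrightarrow> \<exists>u\<in>A. t \<otimes> u = \<one>" for A
  proof (rule F.subfieldI'[OF A])
    fix k assume k: "k \<in> A - {\<zero>}"
    then obtain u where u: "u \<in> A" "k \<otimes> u = \<one>" using inv by blast
    have "inv k = u" using comm_inv_char[of k u] k u subringE(1)[OF A] by auto
    thus "inv k \<in> A" using u(1) by simp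
  qed
  have R: "subfield R S" using subf[OF subring_base base_inverse] .
  have x: "simple_extension R x = carrier S"
    using generator[OF simple_extension_subalgebra[OF generator_closed]]
      simple_extension_mem[OF subring_base generator_closed] .
  show ?thesis
  proof (rule F.finite_subfields_inter[OF R generator_closed x F.simple_extension_imp_algebraic[OF R generator_closed x]])
    fix U assume U: "U \<in> atoms"
    have "e \<in> R" if "e \<in> U" "e \<otimes> e = \<zero> \<or> e \<otimes> e = e" for e
    proof -
      have ec: "e \<in> carrier S" using atom_carrier U that(1) .
      have "e \<otimes> (e \<ominus> \<one>) = e \<otimes> e \<ominus> e" using ec by algebra
      hence "e = \<zero> \<or> e \<ominus> \<one> = \<zero>"
        using that(2) F.integral[of e e] F.integral[of e "e \<ominus> \<one>"] ec by auto
      thus ?thesis using base_closed(1,2) ec by auto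
    qed
    hence "\<forall>t\<in>U. t \<noteq> \<zero> \<longrightarrow> (\<exists>u\<in>U. t \<otimes> u = \<one>)" using atom_cases[OF U] by blast
    thus "subfield U S" using subf[OF atom_subring[OF U]] by blast
    show "R \<subset> U" using atom_base[OF U] atom_neq(1)[OF U] by blast
  next
    fix T U assume "T \<in> atoms" "U \<in> atoms" "T \<noteq> U"
    thus "T \<inter> U = R" by (rule atoms_inter)
  qed
qed

text \<open>Without field atoms, at most one atom contains a new square-zero element. Each of the
  others is generated by a new idempotent, and two such atoms already bound the number of
  idempotents.\<close>

lemma finite_atoms: "finite atoms"
proof (cases "\<exists>T\<in>atoms. \<forall>t\<in>T. t \<noteq> \<zero> \<longrightarrow> (\<exists>u\<in>T. t \<otimes> u = \<one>)")
  case True thus ?thesis using finite_field_atoms by blast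
next
  case False
  let ?N = "{T \<in> atoms. \<exists>e\<in>T. e \<notin> R \<and> e \<otimes> e = \<zero>}"
  let ?I = "{T \<in> atoms. \<exists>e\<in>T. e \<notin> R \<and> e \<otimes> e = e}"
  have "atoms \<subseteq> ?N \<union> ?I" using atom_cases False by blast
  moreover have "finite ?N"
  proof (cases "?N = {}")
    case False
    then obtain T where "T \<in> ?N" by blast
    hence "?N \<subseteq> {T}" using nilpotent_atoms_eq by blast
    thus ?thesis using finite_subset by blast
  qed (metis finite.emptyI)
  moreover have "finite ?I"
  proof (cases "\<exists>T\<in>?I. \<exists>U\<in>?I. T \<noteq> U")
    case True
    then obtain T U e f where "T \<in> atoms" "e \<in> T" "e \<notin> R" "e \<otimes> e = e"
      "U \<in> atoms" "f \<in> U" "f \<notin> R" "f \<otimes> f = f" "T \<noteq> U" by blast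
    hence fin: "finite {s \<in> carrier S. s \<otimes> s = s}" by (rule finite_idempotents)
    have "?I \<subseteq> simple_extension R ` {s \<in> carrier S. s \<otimes> s = s}"
    proof
      fix T assume "T \<in> ?I"
      then obtain e where e: "T \<in> atoms" "e \<in> T" "e \<notin> R" "e \<otimes> e = e" by blast
      thus "T \<in> simple_extension R ` {s \<in> carrier S. s \<otimes> s = s}"
        using atom_simple_extension[OF e(1-3)] atom_carrier[OF e(1,2)] by blast
    qed
    thus ?thesis using fin finite_subset by blast
  next
    case False
    show ?thesis
    proof (cases "?I = {}")
      case nonempty: False
      then obtain T where "T \<in> ?I" by blast
      hence "?I \<subseteq> {T}" using False by blast
      thus ?thesis using finite_subset by blast
    qed (metis finite.emptyI)
  qed
  ultimately show ?thesis by (meson finite_UnI finite_subset)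
qed

end

section \<open>Reduction to zero conductor\<close>

context length_two_extension
begin

lemma finite_subalgebras_iff_atoms: "finite (subalgebras R S) \<longleftrightarrow> finite atoms"
proof
  show "finite (subalgebras R S) \<Longrightarrow> finite atoms"
    unfolding atoms_def by simp
  have "subalgebras R S \<subseteq> atoms \<union> {R, carrier S}" unfolding atoms_def by blast
  thus "finite atoms \<Longrightarrow> finite (subalgebras R S)"
    using finite_subset by blast
qed

lemma finite_subalgebras_conductor_zero:
  assumes "\<And>r. \<lbrakk> r \<in> R; \<And>s. s \<in> carrier S \<Longrightarrow> r \<otimes> s \<in> R \<rbrakk> \<Longrightarrow> r = \<zero>"
  shows "finite (subalgebras R S)"
  unfolding finite_subalgebras_iff_atoms
proof (rule ccontr)
  assume "infinite atoms"
  then obtain B where "finite B" "card B = 3" "B \<subseteq> atoms"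
    using infinite_arbitrarily_large by blast
  then obtain T1 T2 T3 where T: "B = {T1, T2, T3}" "T1 \<noteq> T2" "T1 \<noteq> T3" "T2 \<noteq> T3"
    unfolding card_3_iff by blast
  have ex: "\<exists>T1 T2 T3. T1 \<in> atoms \<and> T2 \<in> atoms \<and> T3 \<in> atoms \<and> T1 \<noteq> T2 \<and> T1 \<noteq> T3 \<and> T2 \<noteq> T3"
    using \<open>B \<subseteq> atoms\<close> T by (intro exI[of _ T1] exI[of _ T2] exI[of _ T3]) simp
  interpret A: three_atoms S R x
    by (rule three_atoms.intro[OF length_two_extension_axioms three_atoms_axioms.intro[OF assms ex]])
  interpret F: length_two_over_field S R x
    by (rule length_two_over_field.intro[OF length_two_extension_axioms
          length_two_over_field_axioms.intro[OF A.base_inverse A.base_nontrivial]])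
  show False using F.finite_atoms \<open>infinite atoms\<close> by simp
qed

section \<open>The conductor ideal and the quotient by it\<close>

definition conductor :: "'a set"
  where "conductor = {r \<in> R. \<forall>s\<in>carrier S. r \<otimes> s \<in> R}"

lemma conductor_ideal: "ideal conductor S"
proof (rule idealI)
  show "ring S" by (rule ring_axioms)
  have cond: "r \<in> carrier S" if "r \<in> conductor" for r
    using that unfolding conductor_def by auto
  have mult: "r \<otimes> t \<in> conductor" if "r \<in> conductor" "t \<in> carrier S" for r t
  proof -
    have "(r \<otimes> t) \<otimes> s = r \<otimes> (t \<otimes> s)" if "s \<in> carrier S" for s
      using cond[OF \<open>r \<in> conductor\<close>] \<open>t \<in> carrier S\<close> that by (rule m_assoc)
    thus ?thesis using that unfolding conductor_def by simp
  qed
  show "subgroup conductor (add_monoid S)"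
  proof (rule add.subgroupI)
    show "conductor \<subseteq> carrier S" using cond by blast
    have "\<zero> \<in> conductor" using base_closed(1) unfolding conductor_def by simp
    thus "conductor \<noteq> {}" by blast
    fix r assume r: "r \<in> conductor"
    have "\<ominus> r = r \<otimes> \<ominus> \<one>" using cond[OF r] by algebra
    thus "\<ominus> r \<in> conductor" using mult[OF r, of "\<ominus> \<one>"] by simp
    fix t assume t: "t \<in> conductor"
    have "(r \<oplus> t) \<otimes> s \<in> R" if "s \<in> carrier S" for s
    proof -
      have "(r \<oplus> t) \<otimes> s = r \<otimes> s \<oplus> t \<otimes> s" using cond[OF r] cond[OF t] that by (rule l_distr)
      thus ?thesis using r t that base_closed(5) unfolding conductor_def by simp
    qed
    thus "r \<oplus> t \<in> conductor" using r t base_closed(5) unfolding conductor_def by simp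
  qed
  show "r \<otimes> t \<in> conductor" if "r \<in> conductor" "t \<in> carrier S" for r t
    using mult that .
  show "t \<otimes> r \<in> conductor" if "r \<in> conductor" "t \<in> carrier S" for r t
    using mult[OF that] m_comm[OF that(2) cond[OF that(1)]] by simp
qed

end

lemma (in ring_hom_ring) vimage_subring:
  assumes "subring A S"
  shows "subring {r \<in> carrier R. h r \<in> A} R"
proof (rule R.subringI)
  note A = subringE[OF assms]
  show "{r \<in> carrier R. h r \<in> A} \<subseteq> carrier R" by blast
  show "\<one> \<in> {r \<in> carrier R. h r \<in> A}" using A(3) by simp
  fix a assume a: "a \<in> {r \<in> carrier R. h r \<in> A}"
  thus "\<ominus> a \<in> {r \<in> carrier R. h r \<in> A}" using A(5) by simp
  fix b assume b: "b \<in> {r \<in> carrier R. h r \<in> A}"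
  show "a \<otimes> b \<in> {r \<in> carrier R. h r \<in> A}" using A(6) a b by simp
  show "a \<oplus> b \<in> {r \<in> carrier R. h r \<in> A}" using A(7) a b by simp
qed

text \<open>Every intermediate ring contains the conductor, so it can be recovered from its image in
  the quotient. The quotient extension satisfies the same axioms and has zero conductor.\<close>

theorem (in length_two_extension) finite_subalgebras: "finite (subalgebras R S)"
proof -
  interpret I: ideal conductor S by (rule conductor_ideal)
  let ?Q = "S Quot conductor" and ?h = "(+>) conductor"
  interpret Q: cring ?Q by (rule I.quotient_is_cring[OF is_cring])
  interpret h: ring_hom_ring S ?Q ?h by (rule I.rcos_ring_hom_ring)
  have surj: "carrier ?Q = ?h ` carrier S"
    unfolding FactRing_def A_RCOSETS_def' by auto
  \<comment> \<open>Two elements with the same image differ by an element of the conductor, which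
    lies in \<open>R\<close> and so in \<open>T\<close>.\<close>
  have reflect: "s \<in> T" if T: "T \<in> subalgebras R S" and s: "s \<in> carrier S" "?h s \<in> ?h ` T" for T s
  proof -
    obtain t where t: "t \<in> T" "?h s = ?h t" using s(2) by blast
    have "s \<in> ?h t" using I.a_rcos_self[OF s(1)] t(2) by simp
    then obtain c where c: "c \<in> conductor" "s = c \<oplus> t"
      unfolding a_r_coset_def' by blast
    have "c \<in> T" using c(1) subalgebraD(2)[OF T] unfolding conductor_def by blast
    thus ?thesis using subringE(7)[OF subalgebraD(1)[OF T] _ t(1)] c(2) by simp
  qed
  define pre where "pre A = {s \<in> carrier S. ?h s \<in> A}" for A
  have pre: "pre A \<in> subalgebras R S" "?h ` pre A = A" if "A \<in> subalgebras (?h ` R) ?Q" for A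
  proof -
    have A: "subring A ?Q" "?h ` R \<subseteq> A" using that unfolding subalgebras_def by auto
    have "R \<subseteq> pre A" using A(2) unfolding pre_def by auto
    thus "pre A \<in> subalgebras R S"
      using subalgebraI[OF h.vimage_subring[OF A(1)]] unfolding pre_def by simp
    have "A \<subseteq> ?h ` carrier S" using subringE(1)[OF A(1)] surj by simp
    thus "?h ` pre A = A" unfolding pre_def by blast
  qed
  have pre_eq: "A = B" if "A \<in> subalgebras (?h ` R) ?Q" "B \<in> subalgebras (?h ` R) ?Q" "pre A = pre B" for A B
    using pre(2)[OF that(1)] pre(2)[OF that(2)] that(3) by metis
  interpret L: length_two_extension ?Q "?h ` R" "?h x"
  proof (intro length_two_extension.intro length_two_extension_axioms.intro)
    show "cring ?Q" by (rule Q.is_cring)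
    show "subring (?h ` R) ?Q" by (rule h.img_is_subring[OF subring_base])
    show "?h x \<in> carrier ?Q" using generator_closed by simp
  next
    fix A assume A: "A \<in> subalgebras (?h ` R) ?Q" and x: "?h x \<in> A"
    have "pre A = carrier S"
      using generator[OF pre(1)[OF A]] x generator_closed unfolding pre_def by simp
    thus "A = carrier ?Q" using pre(2)[OF A] surj by simp
  next
    fix A B assume A: "A \<in> subalgebras (?h ` R) ?Q" and B: "B \<in> subalgebras (?h ` R) ?Q" and "A \<subseteq> B"
    hence "pre A \<subseteq> pre B" unfolding pre_def by blast
    then consider "pre A = R" | "pre A = pre B" | "pre B = carrier S"
      using length_two[OF pre(1)[OF A] pre(1)[OF B]] by blast
    thus "A = ?h ` R \<or> A = B \<or> B = carrier ?Q"
    proof cases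
      case 1 thus ?thesis using pre(2)[OF A] by simp
    next
      case 2 thus ?thesis using pre_eq[OF A B] by simp
    next
      case 3 thus ?thesis using pre(2)[OF B] surj by simp
    qed
  qed
  have "finite (subalgebras (?h ` R) ?Q)"
  \<comment> \<open>A representative of an element of the quotient's conductor multiplies
    \<open>S\<close> into \<open>R\<close>, by \<open>reflect\<close>; it is thus in the conductor,
    and its class is zero.\<close>
  proof (rule L.finite_subalgebras_conductor_zero)
    fix q assume "q \<in> ?h ` R" and mult: "\<And>s. s \<in> carrier ?Q \<Longrightarrow> q \<otimes>\<^bsub>?Q\<^esub> s \<in> ?h ` R"
    then obtain r where r: "r \<in> R" "q = ?h r" by blast
    have "r \<otimes> s \<in> R" if s: "s \<in> carrier S" for s
    proof (rule reflect[OF base_subalgebra])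
      show "r \<otimes> s \<in> carrier S" using r(1) s by simp
      have "?h (r \<otimes> s) = q \<otimes>\<^bsub>?Q\<^esub> ?h s" using h.hom_mult[of r s] r s by simp
      also have "\<dots> \<in> ?h ` R" by (rule mult) (use s in simp)
      finally show "?h (r \<otimes> s) \<in> ?h ` R" .
    qed
    hence "r \<in> conductor" using r(1) unfolding conductor_def by blast
    thus "q = \<zero>\<^bsub>?Q\<^esub>" using r(2) I.a_rcos_const unfolding FactRing_def by simp
  qed
  moreover have "(\<lambda>T. ?h ` T) ` subalgebras R S \<subseteq> subalgebras (?h ` R) ?Q"
    using h.img_is_subring unfolding subalgebras_def by blast
  moreover have "inj_on (\<lambda>T. ?h ` T) (subalgebras R S)"
  proof (rule inj_onI)
    fix T U assume T: "T \<in> subalgebras R S" and U: "U \<in> subalgebras R S" and eq: "?h ` T = ?h ` U"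
    have c: "T \<subseteq> carrier S" "U \<subseteq> carrier S" using subringE(1) subalgebraD(1) T U by blast+
    show "T = U"
    proof (intro equalityI subsetI)
      fix s assume s: "s \<in> T"
      have "?h s \<in> ?h ` U" unfolding eq[symmetric] using s by (rule imageI)
      thus "s \<in> U" by (rule reflect[OF U subsetD[OF c(1) s]])
    next
      fix s assume s: "s \<in> U"
      have "?h s \<in> ?h ` T" unfolding eq using s by (rule imageI)
      thus "s \<in> T" by (rule reflect[OF T subsetD[OF c(2) s]])
    qed
  qed
  ultimately show ?thesis by (meson finite_subset finite_imageD)
qed

theorem theorem6p4:
  fixes R :: "'a set" and S :: "('a, 'b) ring_scheme"
  assumes "simple_ring_extension R S"
    and "extension_length R S = 2"
  shows "FIP R S"
proof -
  have cr: "cring S" and sub: "subring R S"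
    using assms(1) unfolding simple_ring_extension_def ring_extension_def by auto
  interpret cring S by (rule cr)
  obtain x where x: "x \<in> carrier S" "carrier S = simple_extension R x"
    using assms(1) unfolding simple_ring_extension_def by blast
  interpret length_two_extension S R x
  proof (intro length_two_extension.intro length_two_extension_axioms.intro)
    show "cring S" by (rule cr)
    show "subring R S" by (rule sub)
    show "x \<in> carrier S" by (rule x(1))
  next
    fix A assume A: "A \<in> subalgebras R S" "x \<in> A"
    hence "subring A S" "R \<subseteq> A" unfolding subalgebras_def by auto
    thus "A = carrier S"
      using simple_extension_subring_incl[of A R x] A(2) x(2) subringE(1)[of A S] by blast
  next
    fix A B assume A: "A \<in> subalgebras R S" and B: "B \<in> subalgebras R S" and AB: "A \<subseteq> B"
    show "A = R \<or> A = B \<or> B = carrier S"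
    proof (rule ccontr)
      assume neg: "\<not> ?thesis"
      have "R \<subseteq> A" "B \<subseteq> carrier S"
        using A B subringE(1) unfolding subalgebras_def by blast+
      hence strict: "R \<subset> A" "A \<subset> B" "B \<subset> carrier S" using neg AB by blast+
      have mem: "R \<in> subalgebras R S" "carrier S \<in> subalgebras R S"
        using sub carrier_is_subring subringE(1)[OF sub] unfolding subalgebras_def by auto
      \<comment> \<open>A violation of \<open>length_two\<close> is a chain of four rings, with
        three strict inclusions and therefore of length three.\<close>
      define C where "C i = [R, A, B, carrier S] ! i" for i
      have "C i \<in> subalgebras R S" if "i \<le> 3" for i
        using that A B mem unfolding C_def by (auto simp: nth_Cons numeral_3_eq_3 le_Suc_eq)
      moreover have "C i \<subset> C (Suc i)" if "i < 3" for i
        using that strict unfolding C_def by (auto simp: numeral_3_eq_3 less_Suc_eq)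
      ultimately have "enat 3 \<le> extension_length R S"
        unfolding extension_length_def by (intro Sup_upper) blast
      thus False using assms(2) by (simp add: numeral_eq_enat)
    qed
  qed
  show ?thesis unfolding FIP_def by (rule finite_subalgebras)
qed

end
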